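(* Let $G=\langle b,w\rangle$ be a finite group, $N\trianglelefteq G$, $\overline{G}=G/N$, $\overline{b}=bN$, $\overline{w}=wN$, $\mathcal{D}=\mathcal{D}(G,b,w)$ and $\mathcal{D}_N=\mathcal{D}(\overline{G},\overline{b},\overline{w})$. Then (the supporting surface of) $\mathcal{D}$ is an $|N|$-sheeted covering of (that of) $\mathcal{D}_N$ under the natural projection, with exactly $|\overline{G}|\left(\frac{i}{|\overline{b}|}+\frac{j}{|\overline{w}|}+\frac{k}{|\overline{b}\overline{w}|}\right)$ ramification points, where $i,j,k\in\{0,1\}$ satisfy: $i=0\iff\langle b\rangle\cap N=1$, $j=0\iff\langle w\rangle\cap N=1$, and $k=0\iff\langle bw\rangle\cap N=1$. Furthermore $\chi(\mathcal{D})\le|N|\chi(\mathcal{D}_N)$, and equality holds if and only if $\mathcal{D}$ is a smooth covering of $\mathcal{D}_N$, if and only if $N$ acts semiregularly on the set of vertices and faces of $\mathcal{D}$.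
   Context: $\mathcal{D}(G,b,w)$ is the regular dessin with black vertices the right cosets of $\langle b\rangle$, white vertices the right cosets of $\langle w\rangle$, edges the elements of $G$, faces corresponding to right cosets of $\langle bw\rangle$ (each face a disc with boundary walk of length $2|bw|$), embedded in a closed orientable surface; $G$ acts by right multiplication. The natural projection $\mathcal{D}\to\mathcal{D}_N$ sends $\langle b\rangle g\mapsto\langle\overline b\rangle\overline g$, $\langle w\rangle g\mapsto\langle\overline w\rangle\overline g$, $g\mapsto\overline g$, and maps each face disc onto its image face disc by the map $z\mapsto z^{r}$ with $r=|\langle bw\rangle\cap N|$ (unit-disc model, centre to centre). A continuous map $\varphi:\Sigma\to\Sigma'$ of surfaces is an $n$-sheeted covering if all but finitely many points of $\Sigma'$ have exactly $n$ preimages; the ramification points are the points of $\Sigma'$ with fewer than $n$ preimages. The Euler characteristic is $\chi(\mathcal{D})=|V|-|E|+|F|=|G|(\frac1{|b|}+\frac1{|w|}+\frac1{|bw|}-1)$. $\mathcal{D}$ is a smooth covering of $\mathcal{D}_N$ if $(|b|,|w|,|bw|)=(|\overline b|,|\overline w|,|\overline b\overline w|)$. *)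

theory Defs
  imports "HOL-Algebra.Algebra" "HOL-Analysis.Analysis"
begin

text \<open>
  The constructors keep vertices of different colours and faces apart even when the underlying
  cosets coincide as sets (for instance if \<open>\<langle>b\<rangle> = \<langle>w\<rangle>\<close>).
\<close>

datatype 'a cell = Black "'a set" | White "'a set" | Face "'a set"

definition vertices :: "('a, 'c) monoid_scheme \<Rightarrow> 'a \<Rightarrow> 'a \<Rightarrow> 'a cell set" where
  "vertices G b w =
     Black ` (rcosets\<^bsub>G\<^esub> (generate G {b})) \<union> White ` (rcosets\<^bsub>G\<^esub> (generate G {w}))"

definition edges :: "('a, 'c) monoid_scheme \<Rightarrow> 'a \<Rightarrow> 'a \<Rightarrow> 'a set" where
  "edges G b w = carrier G"

definition faces :: "('a, 'c) monoid_scheme \<Rightarrow> 'a \<Rightarrow> 'a \<Rightarrow> 'a cell set" where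
  "faces G b w = Face ` (rcosets\<^bsub>G\<^esub> (generate G {b \<otimes>\<^bsub>G\<^esub> w}))"

definition euler_char :: "('a, 'c) monoid_scheme \<Rightarrow> 'a \<Rightarrow> 'a \<Rightarrow> int" where
  "euler_char G b w =
     int (card (vertices G b w)) - int (card (edges G b w)) + int (card (faces G b w))"

primrec cell_act :: "('a, 'c) monoid_scheme \<Rightarrow> 'a cell \<Rightarrow> 'a \<Rightarrow> 'a cell" where
  "cell_act G (Black C) g = Black (C #>\<^bsub>G\<^esub> g)"
| "cell_act G (White C) g = White (C #>\<^bsub>G\<^esub> g)"
| "cell_act G (Face C) g = Face (C #>\<^bsub>G\<^esub> g)"

definition acts_semiregularly ::
    "('a, 'c) monoid_scheme \<Rightarrow> 'a set \<Rightarrow> ('x \<Rightarrow> 'a \<Rightarrow> 'x) \<Rightarrow> 'x set \<Rightarrow> bool" where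
  "acts_semiregularly G N act \<Omega> \<longleftrightarrow> (\<forall>x\<in>\<Omega>. {n \<in> N. act x n = x} = {\<one>\<^bsub>G\<^esub>})"

definition smooth_covering ::
    "('a, 'c) monoid_scheme \<Rightarrow> 'a \<Rightarrow> 'a \<Rightarrow> ('d, 'e) monoid_scheme \<Rightarrow> 'd \<Rightarrow> 'd \<Rightarrow> bool" where
  "smooth_covering G b w H b' w' \<longleftrightarrow>
     (group.ord G b, group.ord G w, group.ord G (b \<otimes>\<^bsub>G\<^esub> w)) =
     (group.ord H b', group.ord H w', group.ord H (b' \<otimes>\<^bsub>H\<^esub> w'))"

definition quotient_topology :: "'a topology \<Rightarrow> ('a \<times> 'a) set \<Rightarrow> 'a set topology" where
  "quotient_topology T r =
     topology (\<lambda>U. U \<subseteq> topspace T // r \<and> openin T {x \<in> topspace T. r `` {x} \<in> U})"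

lemma openin_quotient_topology:
  "openin (quotient_topology T r) U \<longleftrightarrow>
     U \<subseteq> topspace T // r \<and> openin T {x \<in> topspace T. r `` {x} \<in> U}"
proof -
  let ?P = "\<lambda>U. U \<subseteq> topspace T // r \<and> openin T {x \<in> topspace T. r `` {x} \<in> U}"
  have "istopology ?P"
    unfolding istopology_def
  proof (intro conjI allI impI)
    fix S V assume "?P S" "?P V"
    then have "openin T ({x \<in> topspace T. r `` {x} \<in> S} \<inter> {x \<in> topspace T. r `` {x} \<in> V})"
      by (intro openin_Int) auto
    moreover have "{x \<in> topspace T. r `` {x} \<in> S} \<inter> {x \<in> topspace T. r `` {x} \<in> V}
        = {x \<in> topspace T. r `` {x} \<in> S \<inter> V}" by auto
    ultimately show "openin T {x \<in> topspace T. r `` {x} \<in> S \<inter> V}" by simp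
    show "S \<inter> V \<subseteq> topspace T // r" using \<open>?P S\<close> by auto
  next
    fix \<K> assume K: "\<forall>S\<in>\<K>. ?P S"
    then have "openin T (\<Union>S\<in>\<K>. {x \<in> topspace T. r `` {x} \<in> S})" by (intro openin_Union) auto
    moreover have "(\<Union>S\<in>\<K>. {x \<in> topspace T. r `` {x} \<in> S}) = {x \<in> topspace T. r `` {x} \<in> \<Union>\<K>}"
      by auto
    ultimately show "openin T {x \<in> topspace T. r `` {x} \<in> \<Union>\<K>}" by simp
    show "\<Union>\<K> \<subseteq> topspace T // r" using K by auto
  qed
  then show ?thesis unfolding quotient_topology_def by (simp add: topology_inverse')
qed

lemma topspace_quotient_topology [simp]: "topspace (quotient_topology T r) = topspace T // r"
proof (rule antisym)
  show "topspace (quotient_topology T r) \<subseteq> topspace T // r"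
    unfolding topspace_def openin_quotient_topology by auto
  have "{x \<in> topspace T. r `` {x} \<in> topspace T // r} = topspace T"
    by (auto intro: quotientI)
  then have "openin (quotient_topology T r) (topspace T // r)"
    unfolding openin_quotient_topology by simp
  then show "topspace T // r \<subseteq> topspace (quotient_topology T r)" by (rule openin_subset)
qed

text \<open>
  Let \<open>m\<close> be the order of \<open>b w\<close>. The boundary walk of the face disc of \<open>\<langle>b w\<rangle> g\<close> is
  \<open>g, w g, (b w) g, w (b w) g, \<dots>\<close>: it runs along \<open>g\<close> from the black vertex \<open>\<langle>b\<rangle> g\<close> to the white
  vertex \<open>\<langle>w\<rangle> g\<close>, then along \<open>w g\<close> from \<open>\<langle>w\<rangle> g\<close> to \<open>\<langle>b\<rangle> w g = \<langle>b\<rangle> b w g\<close>, and so on. These \<open>2 m\<close>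
  edges are placed on consecutive arcs of length \<open>\<pi> / m\<close> of the unit circle.

  To avoid choosing a representative \<open>g\<close> for every face, a point of a face disc is written as
  \<open>(g, z)\<close>, where \<open>z\<close> is its coordinate if the walk is made to start with the edge \<open>g\<close> at \<open>z = 1\<close>.
  Rule \<open>rotate\<close> passes from \<open>g\<close> to the representative \<open>(b w) g\<close> of the same face; modulo this rule
  alone, one obtains one closed disc for each right coset of \<open>\<langle>b w\<rangle>\<close>. Every edge \<open>w g\<close> occurs
  twice in boundary walks: black to white, as the first edge of the walk from \<open>w g\<close>, and white to
  black, as the second edge of the walk from \<open>g\<close>. Rule \<open>edge\<close> identifies these two arcs.
\<close>

inductive_set glue :: "('a, 'c) monoid_scheme \<Rightarrow> 'a \<Rightarrow> 'a \<Rightarrow> (('a \<times> complex) \<times> ('a \<times> complex)) set"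
  for G :: "('a, 'c) monoid_scheme" and b w :: 'a where
  refl: "g \<in> carrier G \<Longrightarrow> z \<in> cball 0 1 \<Longrightarrow> ((g, z), (g, z)) \<in> glue G b w"
| sym: "(p, q) \<in> glue G b w \<Longrightarrow> (q, p) \<in> glue G b w"
| trans: "(p, q) \<in> glue G b w \<Longrightarrow> (q, r) \<in> glue G b w \<Longrightarrow> (p, r) \<in> glue G b w"
| rotate: "g \<in> carrier G \<Longrightarrow> z \<in> cball 0 1 \<Longrightarrow>
    ((g, cis (2 * pi / group.ord G (b \<otimes>\<^bsub>G\<^esub> w)) * z), ((b \<otimes>\<^bsub>G\<^esub> w) \<otimes>\<^bsub>G\<^esub> g, z)) \<in> glue G b w"
| edge: "g \<in> carrier G \<Longrightarrow> t \<in> {0..1} \<Longrightarrow>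
    ((w \<otimes>\<^bsub>G\<^esub> g, cis (t * pi / group.ord G (b \<otimes>\<^bsub>G\<^esub> w))),
     (g, cis ((2 - t) * pi / group.ord G (b \<otimes>\<^bsub>G\<^esub> w)))) \<in> glue G b w"

definition surface ::
    "('a, 'c) monoid_scheme \<Rightarrow> 'a \<Rightarrow> 'a \<Rightarrow> ('a \<times> complex) set topology" where
  "surface G b w =
     quotient_topology
       (prod_topology (discrete_topology (carrier G)) (top_of_set (cball 0 1))) (glue G b w)"

definition fibre :: "'a topology \<Rightarrow> ('a \<Rightarrow> 'b) \<Rightarrow> 'b \<Rightarrow> 'a set" where
  "fibre T f y = {x \<in> topspace T. f x = y}"

definition sheeted_covering :: "nat \<Rightarrow> 'a topology \<Rightarrow> 'b topology \<Rightarrow> ('a \<Rightarrow> 'b) \<Rightarrow> bool" where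
  "sheeted_covering n T T' f \<longleftrightarrow>
     continuous_map T T' f \<and>
     finite {y \<in> topspace T'. \<not> (finite (fibre T f y) \<and> card (fibre T f y) = n)}"

definition ramification_points :: "nat \<Rightarrow> 'a topology \<Rightarrow> 'b topology \<Rightarrow> ('a \<Rightarrow> 'b) \<Rightarrow> 'b set" where
  "ramification_points n T T' f = {y \<in> topspace T'. finite (fibre T f y) \<and> card (fibre T f y) < n}"

text \<open>
  In the coordinates above, the projection is \<open>(g, z) \<mapsto> (N g, z ^ r)\<close> with \<open>r = |\<langle>b w\<rangle> \<inter> N|\<close>. As
  the order of \<open>b w\<close> is \<open>r\<close> times that of its image, the arc of an edge \<open>g\<close> is mapped linearly onto
  the arc of \<open>N g\<close>, vertices and face centres to the vertices and face centres given by the images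
  of the cosets.
\<close>

definition lifted_projection ::
    "('a, 'c) monoid_scheme \<Rightarrow> 'a \<Rightarrow> 'a \<Rightarrow> 'a set \<Rightarrow> 'a \<times> complex \<Rightarrow> 'a set \<times> complex" where
  "lifted_projection G b w N =
     (\<lambda>(g, z). (N #>\<^bsub>G\<^esub> g, z ^ card (generate G {b \<otimes>\<^bsub>G\<^esub> w} \<inter> N)))"

definition natural_projection ::
    "('a, 'c) monoid_scheme \<Rightarrow> 'a \<Rightarrow> 'a \<Rightarrow> 'a set \<Rightarrow> ('a \<times> complex) set \<Rightarrow> ('a set \<times> complex) set" where
  "natural_projection G b w N P =
     the_elem ((\<lambda>p. glue (G Mod N) (N #>\<^bsub>G\<^esub> b) (N #>\<^bsub>G\<^esub> w) `` {lifted_projection G b w N p}) ` P)"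

lemma (in group) ord_eq_card_Int_mult_ord_FactGroup:
  assumes "finite (carrier G)" and "N \<lhd> G" and x: "x \<in> carrier G"
  shows "ord x = card (generate G {x} \<inter> N) * group.ord (G Mod N) (N #> x)"
proof -
  interpret N: normal N G by fact
  interpret Q: group "G Mod N" by (rule N.factorgroup_is_group)
  have sN: "subgroup N G" by (rule N.is_subgroup)
  have cx: "N #> x \<in> carrier (G Mod N)"
    using x by (auto simp: FactGroup_def RCOSETS_def)
  have pw: "(N #> x) [^]\<^bsub>G Mod N\<^esub> n = N #> (x [^] n)" for n :: nat
    by (induction n) (use x coset_join2[OF one_closed sN] N.one_closed in \<open>simp_all add: N.rcos_sum\<close>)
  define d where "d = Q.ord (N #> x)"
  have inN: "x [^] n \<in> N \<longleftrightarrow> d dvd n" for n :: nat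
  proof -
    have "x [^] n \<in> N \<longleftrightarrow> N #> (x [^] n) = N"
      using coset_join1[OF _ nat_pow_closed[OF x] sN] coset_join2[OF nat_pow_closed[OF x] sN]
      by blast
    also have "\<dots> \<longleftrightarrow> (N #> x) [^]\<^bsub>G Mod N\<^esub> n = \<one>\<^bsub>G Mod N\<^esub>"
      using pw by (simp add: FactGroup_def)
    finally show ?thesis unfolding d_def using Q.pow_eq_id[OF cx] by simp
  qed
  have ox: "ord x > 0" using ord_ge_1[OF assms(1) x] by simp
  have ddvd: "d dvd ord x"
    using inN[of "ord x"] x by (simp add: N.one_closed)
  have d0: "d \<noteq> 0" using ddvd ox by auto
  have gx: "generate G {x} = {x [^] k | k. k \<in> (UNIV :: nat set)}"
    using generate_pow_nat[OF x] ox by auto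
  have gy: "generate G {x [^] d} = {(x [^] d) [^] k | k. k \<in> (UNIV :: nat set)}"
    using ord_ge_1[OF assms(1) nat_pow_closed[OF x, of d]]
    by (intro generate_pow_nat nat_pow_closed x) simp
  have "generate G {x} \<inter> N = generate G {x [^] d}"
  proof (rule Set.set_eqI)
    fix y
    have "y \<in> generate G {x} \<inter> N \<longleftrightarrow> (\<exists>k::nat. y = x [^] k \<and> d dvd k)"
      unfolding gx using inN by auto
    also have "\<dots> \<longleftrightarrow> y \<in> generate G {x [^] d}"
      unfolding gy using x by (auto simp: nat_pow_pow dvd_def)
    finally show "y \<in> generate G {x} \<inter> N \<longleftrightarrow> y \<in> generate G {x [^] d}" .
  qed
  then have "card (generate G {x} \<inter> N) = ord x div d"
    using generate_pow_card[of "x [^] d"] ord_pow[OF x ddvd d0] x by simp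
  then show ?thesis using ddvd unfolding d_def by simp
qed

lemma glue_domain:
  assumes "group G" "b \<in> carrier G" "w \<in> carrier G" "(p, q) \<in> glue G b w"
  shows "p \<in> carrier G \<times> cball 0 1" "q \<in> carrier G \<times> cball 0 1"
proof -
  interpret group G by fact
  have "p \<in> carrier G \<times> cball 0 1 \<and> q \<in> carrier G \<times> cball 0 1"
    using assms(4) by induction (use assms(2,3) in \<open>auto simp: norm_mult\<close>)
  then show "p \<in> carrier G \<times> cball 0 1" "q \<in> carrier G \<times> cball 0 1" by auto
qed

lemma equiv_glue:
  assumes "group G" "b \<in> carrier G" "w \<in> carrier G"
  shows "equiv (carrier G \<times> cball 0 1) (glue G b w)"
proof (rule equivI)
  show "glue G b w \<subseteq> (carrier G \<times> cball 0 1) \<times> (carrier G \<times> cball 0 1)"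
    using glue_domain[OF assms] by auto
  show "refl_on (carrier G \<times> cball 0 1) (glue G b w)"
    by (auto simp: refl_on_def intro: glue.refl)
  show "sym (glue G b w)" by (auto intro: symI glue.sym)
  show "trans (glue G b w)" by (auto intro: transI glue.trans)
qed

lemma lifted_projection_glue:
  assumes "group G" "finite (carrier G)" "b \<in> carrier G" "w \<in> carrier G" "N \<lhd> G"
    and "(p, q) \<in> glue G b w"
  shows "(lifted_projection G b w N p, lifted_projection G b w N q)
           \<in> glue (G Mod N) (N #>\<^bsub>G\<^esub> b) (N #>\<^bsub>G\<^esub> w)"
proof -
  interpret group G by fact
  interpret N: normal N G by fact
  interpret Q: group "G Mod N" by (rule N.factorgroup_is_group)
  have bw: "b \<otimes>\<^bsub>G\<^esub> w \<in> carrier G" using assms by auto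
  have carr: "N #>\<^bsub>G\<^esub> g \<in> carrier (G Mod N)" if "g \<in> carrier G" for g
    using that by (auto simp: FactGroup_def RCOSETS_def)
  have mult: "(N #>\<^bsub>G\<^esub> g) \<otimes>\<^bsub>G Mod N\<^esub> (N #>\<^bsub>G\<^esub> h) = N #>\<^bsub>G\<^esub> (g \<otimes>\<^bsub>G\<^esub> h)"
    if "g \<in> carrier G" "h \<in> carrier G" for g h
    using that by (simp add: FactGroup_def N.rcos_sum)
  define r where "r = card (generate G {b \<otimes>\<^bsub>G\<^esub> w} \<inter> N)"
  define m where "m = ord (b \<otimes>\<^bsub>G\<^esub> w)"
  define m' where "m' = Q.ord (N #>\<^bsub>G\<^esub> (b \<otimes>\<^bsub>G\<^esub> w))"
  have m: "m = r * m'"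
    unfolding m_def r_def m'_def by (rule ord_eq_card_Int_mult_ord_FactGroup[OF assms(2,5) bw])
  have "m > 0" unfolding m_def using ord_ge_1[OF assms(2) bw] by simp
  then have r0: "r \<noteq> 0" "m' \<noteq> 0" using m by auto
  have cisr: "cis (s / real m) ^ r = cis (s / real m')" for s
    using r0 by (simp add: Complex.DeMoivre m)
  have pow_ball: "z ^ r \<in> cball 0 1" if "z \<in> cball 0 1" for z :: complex
    using that by (simp add: norm_power power_le_one)
  show ?thesis
    using assms(6)
  proof induction
    case (refl g z)
    then show ?case
      using pow_ball by (auto simp: lifted_projection_def simp flip: r_def intro!: glue.refl carr)
  next
    case (sym p q) from sym.IH show ?case by (rule glue.sym)
  next
    case (trans p q s) from trans.IH show ?case by (rule glue.trans)
  next
    case (rotate g z)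
    show ?case
      using glue.rotate[of "N #>\<^bsub>G\<^esub> g" "G Mod N" "z ^ r" "N #>\<^bsub>G\<^esub> b" "N #>\<^bsub>G\<^esub> w"]
        rotate assms(3,4) bw carr pow_ball
      by (simp add: lifted_projection_def mult power_mult_distrib cisr
          del: mult_FactGroup flip: r_def m_def m'_def)
  next
    case (edge g t)
    show ?case
      using glue.edge[of "N #>\<^bsub>G\<^esub> g" "G Mod N" t "N #>\<^bsub>G\<^esub> w" "N #>\<^bsub>G\<^esub> b"] edge assms(3,4) bw carr
      by (simp add: lifted_projection_def mult cisr del: mult_FactGroup
          flip: r_def m_def m'_def)
  qed
qed

lemma natural_projection_class:
  assumes "group G" "finite (carrier G)" "b \<in> carrier G" "w \<in> carrier G" "N \<lhd> G"
    and "p \<in> carrier G \<times> cball 0 1"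
  shows "natural_projection G b w N (glue G b w `` {p}) =
           glue (G Mod N) (N #>\<^bsub>G\<^esub> b) (N #>\<^bsub>G\<^esub> w) `` {lifted_projection G b w N p}"
proof -
  let ?B = "N #>\<^bsub>G\<^esub> b" and ?W = "N #>\<^bsub>G\<^esub> w"
  interpret N: normal N G by fact
  have "equiv (carrier (G Mod N) \<times> cball 0 1) (glue (G Mod N) ?B ?W)"
    using assms(3,4) by (intro equiv_glue N.factorgroup_is_group)
      (auto simp: FactGroup_def RCOSETS_def)
  then have cls: "glue (G Mod N) ?B ?W `` {lifted_projection G b w N q} =
      glue (G Mod N) ?B ?W `` {lifted_projection G b w N p}" if "q \<in> glue G b w `` {p}" for q
    using lifted_projection_glue[OF assms(1-5), of p q] that
    by (metis Image_singleton_iff equiv_class_eq)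
  have "(p, p) \<in> glue G b w" using assms(6) by (auto intro: glue.refl)
  then have ne: "glue G b w `` {p} \<noteq> {}" by blast
  have "(\<lambda>q. glue (G Mod N) ?B ?W `` {lifted_projection G b w N q}) ` (glue G b w `` {p}) =
      (\<lambda>q. glue (G Mod N) ?B ?W `` {lifted_projection G b w N p}) ` (glue G b w `` {p})"
    by (rule image_cong[OF HOL.refl cls])
  also have "\<dots> = {glue (G Mod N) ?B ?W `` {lifted_projection G b w N p}}"
    using ne by (simp only: image_constant_conv if_False)
  finally show ?thesis by (simp only: natural_projection_def the_elem_eq)
qed

end

theory Submission
  imports Defs
begin

text \<open>
  Every point of the surface can be moved into a \<open>canonical\<close> position: inside a face disc, or on the
  first edge of a boundary walk. For a fixed canonical coordinate \<open>u\<close>, the points \<open>(g, u)\<close> and \<open>(h, u)\<close>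
  are glued exactly if \<open>h\<close> lies in the right coset \<open>S g\<close>, where \<open>S\<close> is \<open>\<langle>b w\<rangle>\<close>, \<open>\<langle>b\<rangle>\<close>, \<open>\<langle>w\<rangle>\<close> at the
  face centre, the black vertex and the white vertex, and is trivial elsewhere. As every gluing
  step downstairs lifts, the fibre over the image of \<open>(g, u)\<close> consists of the classes of the points
  \<open>(n g, u)\<close> with \<open>n \<in> N\<close>; hence it has \<open>|N| / |N \<inter> S|\<close> elements. Ramification thus occurs only over
  vertices and face centres, which are counted by cosets in the quotient group. The Euler
  characteristics are compared summand by summand, using \<open>|x| = |\<langle>x\<rangle> \<inter> N| |N x|\<close>.
\<close>

subsection \<open>Gluing classes in canonical position\<close>

lemma cis_scaled_eq_iff:
  fixes m :: nat and s t :: real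
  assumes "m > 0"
  shows "cis (s * pi / m) = cis (t * pi / m) \<longleftrightarrow> (\<exists>k::int. s = t + 2 * real m * real_of_int k)"
proof -
  have "cis (s * pi / m) = cis (t * pi / m) \<longleftrightarrow>
      sin (s * pi / m) = sin (t * pi / m) \<and> cos (s * pi / m) = cos (t * pi / m)"
    by (auto simp: complex_eq_iff)
  also have "\<dots> \<longleftrightarrow> (\<exists>k::int. s * pi / m = t * pi / m + 2 * pi * k)"
    by (rule sin_cos_eq_iff)
  also have "\<dots> \<longleftrightarrow> (\<exists>k::int. s = t + 2 * real m * real_of_int k)"
  proof -
    have "s * pi / m = t * pi / m + 2 * pi * k \<longleftrightarrow> s = t + 2 * m * k" for k :: int
    proof -
      have "s * pi / m = t * pi / m + 2 * pi * k \<longleftrightarrow> s * pi = (t + 2 * m * k) * pi"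
        using assms by (simp add: field_simps)
      then show ?thesis by simp
    qed
    then show ?thesis by simp
  qed
  finally show ?thesis .
qed

lemma (in group) mult_inv_cancel_left:
  assumes "a \<in> carrier G" "y \<in> carrier G"
  shows "a \<otimes> (inv a \<otimes> y) = y" "inv a \<otimes> (a \<otimes> y) = y"
  using assms by (simp_all flip: m_assoc)

locale dessin = group G for G (structure) +
  fixes b w :: 'a
  assumes finite_carrier: "finite (carrier G)"
    and b_closed [simp]: "b \<in> carrier G"
    and w_closed [simp]: "w \<in> carrier G"
begin

abbreviation face_gen where "face_gen \<equiv> b \<otimes> w"
abbreviation face_deg where "face_deg \<equiv> ord face_gen"

text \<open>\<open>bdry s\<close> is the point at distance \<open>s\<close> along a boundary walk, in units of one edge.\<close>

definition bdry :: "real \<Rightarrow> complex" where "bdry s = cis (s * pi / face_deg)"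

text \<open>An edge occupies two boundary arcs, identified by the rule \<open>edge\<close>. Keeping
  only the first arc of each walk, with both end points, makes \<open>(g, bdry t)\<close> the point
  of the edge \<open>g\<close> at distance \<open>t\<close> from its black end.\<close>

definition canonical :: "complex set" where "canonical = ball 0 1 \<union> bdry ` {0..1}"

definition stab :: "complex \<Rightarrow> 'a set" where
  "stab u = (if u = 0 then generate G {face_gen}
             else if u = bdry 0 then generate G {b}
             else if u = bdry 1 then generate G {w} else {\<one>})"

definition cls :: "'a \<Rightarrow> complex \<Rightarrow> ('a \<times> complex) set" where
  "cls g z = glue G b w `` {(g, z)}"

section \<open>Boundary parameters and rotations of a face disc\<close>

lemma face_deg_pos: "face_deg > 0"
  using ord_ge_1[OF finite_carrier, of face_gen] by simp

lemma bdry_eq_iff: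
  fixes s t :: real
  shows "bdry s = bdry t \<longleftrightarrow> (\<exists>k::int. s = t + 2 * real face_deg * real_of_int k)"
  unfolding bdry_def by (rule cis_scaled_eq_iff[OF face_deg_pos])

lemma bdry_0 [simp]: "bdry 0 = 1"
  by (simp add: bdry_def)

lemma norm_bdry [simp]: "norm (bdry s) = 1"
  by (simp add: bdry_def)

lemma bdry_nonzero [simp]: "bdry s \<noteq> 0"
  using norm_bdry[of s] by fastforce

lemma bdry_add: "bdry (s + t) = bdry s * bdry t"
  by (simp add: bdry_def cis_mult add_divide_distrib distrib_right)

text \<open>Parameters of one boundary point differ by multiples of \<open>2 * face_deg\<close>,
  hence by even integers. So the two ends of an edge keep distinct coordinates, even in a face of
  degree 1.\<close>

lemma bdry_1_neq_1: "bdry 1 \<noteq> 1"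
proof
  assume "bdry 1 = 1"
  then have "bdry 1 = bdry 0" by simp
  then obtain k :: int where "1 = 2 * real face_deg * k"
    unfolding bdry_eq_iff by auto
  then have "real_of_int 1 = real_of_int (2 * int face_deg * k)" by simp
  then have "1 = 2 * int face_deg * k" by (simp only: of_int_eq_iff)
  then have "2 dvd (1 :: int)" by (metis dvd_triv_left mult.assoc)
  then show False by simp
qed

lemma canonical_subset: "canonical \<subseteq> cball 0 1"
  by (auto simp: canonical_def)

text \<open>Both sides say that \<open>face_deg\<close> divides \<open>k\<close>: a rotation by
  \<open>2 * k\<close> arcs is trivial exactly when the power of \<open>face_gen\<close> that it
  induces on labels is.\<close>

lemma bdry_even_eq_1_iff: "bdry (2 * of_int k) = 1 \<longleftrightarrow> face_gen [^] (k::int) = \<one>"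
proof -
  have "bdry (2 * of_int k) = 1 \<longleftrightarrow> bdry (2 * of_int k) = bdry 0" by simp
  also have "\<dots> \<longleftrightarrow> (\<exists>l::int. 2 * real_of_int k = 2 * face_deg * l)"
    unfolding bdry_eq_iff by simp
  also have "\<dots> \<longleftrightarrow> (\<exists>l::int. real_of_int k = real_of_int (int face_deg * l))"
    by simp
  also have "\<dots> \<longleftrightarrow> int face_deg dvd k" by (simp only: of_int_eq_iff dvd_def)
  also have "\<dots> \<longleftrightarrow> face_gen [^] k = \<one>" by (simp add: int_pow_eq_id)
  finally show ?thesis .
qed

section \<open>Points forced to be glued\<close>

lemma glue_dom:
  assumes "((g, y), (h, z)) \<in> glue G b w"
  shows "g \<in> carrier G" "h \<in> carrier G" "y \<in> cball 0 1" "z \<in> cball 0 1"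
  using glue_domain[OF is_group b_closed w_closed assms] by auto

lemma cls_eq_iff:
  assumes "g \<in> carrier G" "h \<in> carrier G" "y \<in> cball 0 1" "z \<in> cball 0 1"
  shows "cls g y = cls h z \<longleftrightarrow> ((g, y), (h, z)) \<in> glue G b w"
  unfolding cls_def using assms
  by (intro eq_equiv_class_iff[OF equiv_glue[OF is_group b_closed w_closed]]) auto

lemma glue_rotate:
  assumes "g \<in> carrier G" "z \<in> cball 0 1"
  shows "((g, bdry 2 * z), (face_gen \<otimes> g, z)) \<in> glue G b w"
  using glue.rotate[OF assms] by (simp add: bdry_def)

lemma glue_edge:
  assumes "g \<in> carrier G" "t \<in> {0..1}"
  shows "((w \<otimes> g, bdry t), (g, bdry (2 - t))) \<in> glue G b w"
  using glue.edge[OF assms] by (simp add: bdry_def)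

lemma glue_rotate_pow:
  assumes "g \<in> carrier G" "z \<in> cball 0 1"
  shows "((g, bdry (2 * of_int k) * z), (face_gen [^] (k::int) \<otimes> g, z)) \<in> glue G b w"
proof -
  have nat: "((g, bdry (2 * real n) * z), (face_gen [^] n \<otimes> g, z)) \<in> glue G b w" for n :: nat
    using assms
  proof (induction n arbitrary: g)
    case 0
    then show ?case by (auto intro: glue.refl)
  next
    case (Suc n)
    have "((g, bdry 2 * (bdry (2 * real n) * z)), (face_gen \<otimes> g, bdry (2 * real n) * z))
        \<in> glue G b w"
      using Suc.prems by (intro glue_rotate) (auto simp: norm_mult)
    moreover have "((face_gen \<otimes> g, bdry (2 * real n) * z),
        (face_gen [^] n \<otimes> (face_gen \<otimes> g), z)) \<in> glue G b w"
      using Suc.prems by (intro Suc.IH) auto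
    moreover have "bdry 2 * (bdry (2 * real n) * z) = bdry (2 * real (Suc n)) * z"
      by (simp add: bdry_add distrib_left)
    ultimately show ?case
      using Suc.prems by (auto intro: glue.trans simp: m_assoc)
  qed
  \<comment> \<open>Rotation and power both depend on \<open>k\<close> only modulo
    \<open>face_deg\<close>, so negative exponents reduce to the natural case.\<close>
  define n where "n = nat (k mod int face_deg)"
  have n: "int n = k - face_deg * (k div face_deg)"
    using face_deg_pos by (simp add: n_def minus_mult_div_eq_mod)
  have "bdry (2 * of_int k) = bdry (2 * real n)"
  proof -
    have "real_of_int (int n) = real_of_int (k - face_deg * (k div face_deg))" using n by simp
    then have "2 * real_of_int k = 2 * real n + 2 * real face_deg * real_of_int (k div face_deg)"
      by (simp add: algebra_simps)
    then show ?thesis unfolding bdry_eq_iff by blast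
  qed
  moreover have "face_gen [^] k = face_gen [^] n"
  proof -
    have "int face_deg dvd k - int n" using n by simp
    then have "face_gen [^] k = face_gen [^] int n"
      using int_pow_eq[of face_gen "int n" k] by simp
    then show ?thesis by (simp add: int_pow_int)
  qed
  ultimately show ?thesis using nat[of n] by simp
qed

text \<open>Extends gluing along the generator \<open>c\<close> to the subgroup it generates. As
  \<open>step\<close> holds at every label, an inverse is obtained by reading it backwards from
  \<open>inv c \<otimes> g\<close>.\<close>

lemma glue_generate:
  assumes c: "c \<in> carrier G" and u: "u \<in> cball 0 1"
    and step: "\<And>g. g \<in> carrier G \<Longrightarrow> ((g, u), (c \<otimes> g, u)) \<in> glue G b w"
    and x: "x \<in> generate G {c}" and g: "g \<in> carrier G"
  shows "((g, u), (x \<otimes> g, u)) \<in> glue G b w"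
  using x g
proof (induction arbitrary: g)
  case one
  then show ?case using u by (auto intro: glue.refl)
next
  case (incl h)
  then show ?case using step by simp
next
  case (inv h)
  then have "((inv c \<otimes> g, u), (g, u)) \<in> glue G b w"
    using step[of "inv c \<otimes> g"] c by (simp add: m_assoc[symmetric])
  then show ?case using inv by (auto intro: glue.sym)
next
  case (eng h1 h2)
  have "h1 \<in> carrier G" "h2 \<in> carrier G"
    using eng.hyps generate_in_carrier[of "{c}"] c by auto
  then show ?case
    using eng.IH(2)[OF eng.prems] eng.IH(1)[of "h2 \<otimes> g"] eng.prems
    by (auto intro: glue.trans simp: m_assoc)
qed

text \<open>Turning about a black vertex: cross the edge \<open>g\<close> into the disc seen from
  \<open>?h\<close>, where its black end is the end \<open>bdry 2\<close> of the second arc, and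
  rotate this point to the start of the walk from \<open>face_gen \<otimes> ?h\<close>.\<close>

lemma glue_black:
  assumes "g \<in> carrier G"
  shows "((g, 1), (b \<otimes> g, 1)) \<in> glue G b w"
proof -
  let ?h = "inv w \<otimes> g"
  have "((w \<otimes> ?h, bdry 0), (?h, bdry 2 * 1)) \<in> glue G b w"
    using glue_edge[of ?h 0] assms by simp
  moreover have "((?h, bdry 2 * 1), (face_gen \<otimes> ?h, 1)) \<in> glue G b w"
    using assms by (intro glue_rotate) auto
  moreover have "w \<otimes> ?h = g" "face_gen \<otimes> ?h = b \<otimes> g"
    using assms by (simp_all add: m_assoc[symmetric]) (simp add: m_assoc)
  ultimately show ?thesis by (auto intro: glue.trans)
qed

text \<open>The white end is the point \<open>t = 1\<close>, where the two parameters
  \<open>t\<close> and \<open>2 - t\<close> of the rule \<open>edge\<close> agree.\<close>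

lemma glue_white:
  assumes "g \<in> carrier G"
  shows "((g, bdry 1), (w \<otimes> g, bdry 1)) \<in> glue G b w"
  using glue_edge[of g 1] assms by (auto intro: glue.sym)

lemma glue_centre:
  assumes "g \<in> carrier G"
  shows "((g, 0), (face_gen \<otimes> g, 0)) \<in> glue G b w"
  using glue_rotate[of g 0] assms by simp

lemma glue_stab:
  assumes "u \<in> canonical" "x \<in> stab u" "g \<in> carrier G"
  shows "((g, u), (x \<otimes> g, u)) \<in> glue G b w"
proof -
  have u: "u \<in> cball 0 1" using assms(1) canonical_subset by auto
  have gen: "((g, u), (x \<otimes> g, u)) \<in> glue G b w"
    if "c \<in> carrier G" "x \<in> generate G {c}"
      and "\<And>g. g \<in> carrier G \<Longrightarrow> ((g, u), (c \<otimes> g, u)) \<in> glue G b w" for c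
    using that(1) u that(3,2) assms(3) by (rule glue_generate)
  note gen' = gen[OF m_closed[OF b_closed w_closed]] gen[OF b_closed] gen[OF w_closed]
  show ?thesis
  proof (cases "u = 0 \<or> u = bdry 0 \<or> u = bdry 1")
    case True
    then show ?thesis
      using gen' assms(2) glue_centre glue_black glue_white
      by (simp add: stab_def split: if_splits)
  next
    case False
    then show ?thesis using assms u by (simp add: stab_def glue.refl)
  qed
qed

lemma stab_subgroup: "subgroup (stab u) G"
  by (simp add: stab_def generate_is_subgroup triv_subgroup)

lemma ex_canonical:
  assumes "g \<in> carrier G" "z \<in> cball 0 1"
  shows "\<exists>h\<in>carrier G. \<exists>u\<in>canonical. ((g, z), (h, u)) \<in> glue G b w"
proof (cases "norm z < 1")
  case True
  then show ?thesis using assms by (auto simp: canonical_def intro!: bexI glue.refl)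
next
  case False
  then have "norm z = 1" using assms by auto
  then obtain \<theta> where "z = cis \<theta>" 
    by (metis rcis_cmod_Arg rcis_def mult_1 of_real_1)
  then have z: "z = bdry (\<theta> * face_deg / pi)" using face_deg_pos by (simp add: bdry_def)
  define y where "y = \<theta> * face_deg / pi"
  \<comment> \<open>Rotation by \<open>k\<close> brings the parameter into \<open>[0, 2)\<close>,
    onto the first two arcs of a walk.\<close>
  define k where "k = \<lfloor>y / 2\<rfloor>"
  define s where "s = y - 2 * real_of_int k"
  have s: "0 \<le> s" "s < 2" unfolding s_def k_def by linarith+
  let ?h = "face_gen [^] k \<otimes> g"
  have h: "?h \<in> carrier G" using assms by auto
  have "z = bdry (2 * k) * bdry s" unfolding z y_def[symmetric] by (simp add: s_def flip: bdry_add)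
  then have gl: "((g, z), (?h, bdry s)) \<in> glue G b w"
    using glue_rotate_pow[of g "bdry s" k] assms by simp
  show ?thesis
  proof (cases "s \<le> 1")
    case True
    then have "bdry s \<in> canonical" using s by (auto simp: canonical_def)
    then show ?thesis using gl h by blast
  next
    case False
    \<comment> \<open>From the second arc, the rule \<open>edge\<close> leads to the first arc of
      the walk from \<open>w \<otimes> ?h\<close>.\<close>
    then have "((w \<otimes> ?h, bdry (2 - s)), (?h, bdry s)) \<in> glue G b w"
      using glue_edge[of ?h "2 - s"] h s by simp
    then have "((g, z), (w \<otimes> ?h, bdry (2 - s))) \<in> glue G b w"
      using gl by (blast intro: glue.trans glue.sym)
    moreover have "bdry (2 - s) \<in> canonical" using s False by (auto simp: canonical_def)
    ultimately show ?thesis using h by (blast intro: m_closed w_closed)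
  qed
qed

section \<open>Invariants separating the gluing classes\<close>

lemma bdry_eq_even_shift_iff:
  fixes s t :: real and k :: int
  shows "bdry t = bdry (2 * real_of_int k + s) \<longleftrightarrow>
    (\<exists>j::int. t - s = 2 * real_of_int j \<and> face_gen [^] k = face_gen [^] j)"
proof -
  have "t = 2 * real_of_int k + s + 2 * real face_deg * real_of_int l \<longleftrightarrow>
      t - s = 2 * real_of_int (k + int face_deg * l)" for l
    by (auto simp: algebra_simps)
  then have "bdry t = bdry (2 * real_of_int k + s) \<longleftrightarrow>
      (\<exists>l. t - s = 2 * real_of_int (k + int face_deg * l))"
    unfolding bdry_eq_iff by presburger
  \<comment> \<open>The circle determines \<open>k\<close> only modulo \<open>face_deg\<close>,
    which is all that the power of \<open>face_gen\<close> depends on. Hence \<open>k\<close> can be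
    traded for the true half difference \<open>j\<close>.\<close>
  also have "\<dots> \<longleftrightarrow> (\<exists>j. t - s = 2 * real_of_int j \<and> int face_deg dvd j - k)"
    by (metis add_diff_cancel_left' diff_add_cancel add.commute dvd_def)
  finally show ?thesis by (simp add: int_pow_eq)
qed

lemma bdry_2_mult_eq_iff: "bdry 2 * z = bdry (2 * real_of_int (k + 1) + s) * y
    \<longleftrightarrow> z = bdry (2 * real_of_int k + s) * y"
proof -
  have "bdry (2 * real_of_int (k + 1) + s) = bdry 2 * bdry (2 * real_of_int k + s)"
    by (simp add: algebra_simps flip: bdry_add)
  then show ?thesis by simp
qed

lemma face_gen_pow_Suc:
  "face_gen [^] (k + 1 :: int) = face_gen [^] k \<otimes> face_gen"
  "face_gen [^] (k + 1 :: int) = face_gen \<otimes> face_gen [^] k"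
proof -
  have f: "face_gen \<in> carrier G" by simp
  have *: "face_gen [^] (i + j) = face_gen [^] i \<otimes> face_gen [^] j" for i j :: int
    by (rule int_pow_mult[OF f])
  show "face_gen [^] (k + 1 :: int) = face_gen [^] k \<otimes> face_gen"
    using *[of k 1] by (simp add: int_pow_1)
  show "face_gen [^] (k + 1 :: int) = face_gen \<otimes> face_gen [^] k"
    using *[of 1 k] by (simp add: int_pow_1 add.commute)
qed

lemma ex_int_shift: "(\<exists>k::int. P k) \<longleftrightarrow> (\<exists>k. P (k + 1))"
  by (metis diff_add_cancel)

text \<open>
  \<open>reach S s p\<close> collects the cosets \<open>S h\<close> of the edges \<open>h\<close> on which \<open>p\<close> is the point with parameter
  \<open>s\<close>: such a point is seen from the face of \<open>h\<close> or, in the opposite direction, from the other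
  face along \<open>h\<close>. It is constant on gluing classes as soon as \<open>S\<close> absorbs the choice of the edge at
  the two vertices.
\<close>

definition reach :: "'a set \<Rightarrow> real \<Rightarrow> 'a \<times> complex \<Rightarrow> 'a set" where
  "reach S s p =
     {x \<otimes> (face_gen [^] k \<otimes> fst p) | x k. x \<in> S \<and> snd p = bdry (2 * real_of_int (k::int) + s)} \<union>
     {x \<otimes> (w \<otimes> (face_gen [^] k \<otimes> fst p)) | x k.
        x \<in> S \<and> snd p = bdry (2 * real_of_int (k::int) + (2 - s))}"

lemma reachI:
  assumes "x \<in> S"
  shows "z = bdry (2 * real_of_int k + s) \<Longrightarrow> x \<otimes> (face_gen [^] k \<otimes> g) \<in> reach S s (g, z)"
    and "z = bdry (2 * real_of_int k + (2 - s)) \<Longrightarrow>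
      x \<otimes> (w \<otimes> (face_gen [^] k \<otimes> g)) \<in> reach S s (g, z)"
  using assms unfolding reach_def by auto

text \<open>Passing to the representative \<open>face_gen \<otimes> g\<close> shifts the exponent by
  one in both families of \<open>reach\<close>, and the exponent ranges over all integers.\<close>

lemma reach_rotate:
  assumes "g \<in> carrier G"
  shows "reach S s (g, bdry 2 * z) = reach S s (face_gen \<otimes> g, z)"
proof -
  have z: "bdry 2 * z = bdry (2 * real_of_int (k + 1) + y) \<longleftrightarrow> z = bdry (2 * real_of_int k + y)"
    for k :: int and y
    using bdry_2_mult_eq_iff[of z k y 1] by simp
  have f: "face_gen [^] (k + 1) \<otimes> g = face_gen [^] k \<otimes> (face_gen \<otimes> g)" for k :: int
    using assms by (simp add: face_gen_pow_Suc(1) m_assoc)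
  let ?P = "\<lambda>h k. \<exists>x\<in>S.
    h = x \<otimes> (face_gen [^] k \<otimes> g) \<and> bdry 2 * z = bdry (2 * real_of_int k + s) \<or>
    h = x \<otimes> (w \<otimes> (face_gen [^] k \<otimes> g)) \<and> bdry 2 * z = bdry (2 * real_of_int k + (2 - s))"
  have "h \<in> reach S s (g, bdry 2 * z) \<longleftrightarrow> (\<exists>k. ?P h k)" for h
    unfolding reach_def by auto
  moreover have "h \<in> reach S s (face_gen \<otimes> g, z) \<longleftrightarrow> (\<exists>k. ?P h (k + 1))" for h
    unfolding reach_def f z by auto
  ultimately show ?thesis using ex_int_shift[of "?P _"] by blast
qed

text \<open>Coincidence of boundary points makes \<open>t - s\<close> or \<open>t + s\<close> an
  even integer. In the unit interval the first forces \<open>t = s\<close>, the second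
  \<open>t = s = 0\<close> or \<open>t = s = 1\<close>. The latter are the two vertices, where the
  surplus factor is \<open>b\<close> or \<open>w\<close> or an inverse of these, and is absorbed by
  \<open>S\<close>.\<close>

lemma reach_bdry:
  assumes S: "subgroup S G" and s: "s \<in> {0..1}" and t: "t \<in> {0..1}" and g: "g \<in> carrier G"
    and bS: "s = 0 \<Longrightarrow> b \<in> S" and wS: "s = 1 \<Longrightarrow> w \<in> S"
  shows "reach S s (g, bdry t) = (if t = s then S #> g else {})"
    and "reach S s (g, bdry (2 - t)) = (if t = s then S #> (w \<otimes> g) else {})"
proof -
  interpret S: subgroup S G by fact
  \<comment> \<open>The reversed arc has parameter \<open>2 * k + (2 - s) = 2 * (k + 1) - s\<close>,
    so the comparison determines the power with exponent \<open>k + 1\<close>; this recovers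
    exponent \<open>k\<close>.\<close>
  have fS: "face_gen [^] k = inv face_gen \<otimes> face_gen [^] (k + 1)" for k :: int
    using inv_solve_left[of "face_gen [^] k" face_gen "face_gen [^] (k + 1)"]
    by (simp add: face_gen_pow_Suc(2))
  have sub1: "reach S s (g, bdry t) \<subseteq> (if t = s then S #> g else {})"
  proof
    fix h assume "h \<in> reach S s (g, bdry t)"
    then consider (A) x k where "x \<in> S" "h = x \<otimes> (face_gen [^] (k::int) \<otimes> g)"
          "bdry t = bdry (2 * real_of_int k + s)"
      | (B) x k where "x \<in> S" "h = x \<otimes> (w \<otimes> (face_gen [^] (k::int) \<otimes> g))"
          "bdry t = bdry (2 * real_of_int k + (2 - s))"
      unfolding reach_def by auto
    then show "h \<in> (if t = s then S #> g else {})"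
    proof cases
      case A
      then obtain j :: int where j: "t - s = 2 * real_of_int j" "face_gen [^] k = face_gen [^] j"
        unfolding bdry_eq_even_shift_iff by blast
      then have "\<bar>real_of_int j\<bar> < 1" using s t by auto
      then have "j = 0" by linarith
      moreover have "t = s" using j(1) \<open>j = 0\<close> by simp
      ultimately show ?thesis using A(1,2) j(2) g by (auto simp: r_coset_def)
    next
      case B
      then have "bdry t = bdry (2 * real_of_int (k + 1) + (- s))" by (simp add: algebra_simps)
      then obtain j :: int where "t - - s = 2 * real_of_int j" and
          j2: "face_gen [^] (k + 1) = face_gen [^] j"
        unfolding bdry_eq_even_shift_iff by blast
      then have j: "t + s = 2 * real_of_int j" by simp
      then have "real_of_int j > -1" "real_of_int j < 2" using s t by auto
      then consider "j = 0" | "j = 1" by linarith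
      then show ?thesis
      proof cases
        case 1
        then have ts: "t = 0" "s = 0" using j s t by auto
        have "face_gen [^] k = inv face_gen" using fS[of k] j2 1 by simp
        then have "h = (x \<otimes> inv b) \<otimes> g"
          using B(1,2) g
          by (simp add: inv_mult_group m_assoc S.mem_carrier mult_inv_cancel_left)
        moreover have "x \<otimes> inv b \<in> S" using bS[OF ts(2)] B(1) by simp
        ultimately show ?thesis using ts by (auto simp: r_coset_def)
      next
        case 2
        then have ts: "t = 1" "s = 1" using j s t by auto
        have "face_gen [^] k = \<one>" using fS[of k] j2 2 by simp
        then have "h = (x \<otimes> w) \<otimes> g" using B(1,2) g by (simp add: m_assoc S.mem_carrier)
        moreover have "x \<otimes> w \<in> S" using wS[OF ts(2)] B(1) by simp
        ultimately show ?thesis using ts by (auto simp: r_coset_def)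
      qed
    qed
  qed
  have sub2: "reach S s (g, bdry (2 - t)) \<subseteq> (if t = s then S #> (w \<otimes> g) else {})"
  proof
    fix h assume "h \<in> reach S s (g, bdry (2 - t))"
    then consider (A) x k where "x \<in> S" "h = x \<otimes> (face_gen [^] (k::int) \<otimes> g)"
          "bdry (2 - t) = bdry (2 * real_of_int k + s)"
      | (B) x k where "x \<in> S" "h = x \<otimes> (w \<otimes> (face_gen [^] (k::int) \<otimes> g))"
          "bdry (2 - t) = bdry (2 * real_of_int k + (2 - s))"
      unfolding reach_def by auto
    then show "h \<in> (if t = s then S #> (w \<otimes> g) else {})"
    proof cases
      case A
      then obtain j :: int where j: "2 - t - s = 2 * real_of_int j" "face_gen [^] k = face_gen [^] j"
        unfolding bdry_eq_even_shift_iff by blast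
      then have "real_of_int j > -1" "real_of_int j < 2" using s t by auto
      then consider "j = 0" | "j = 1" by linarith
      then show ?thesis
      proof cases
        case 1
        then have ts: "t = 1" "s = 1" using j s t by auto
        have "h = (x \<otimes> inv w) \<otimes> (w \<otimes> g)"
          using A(1,2) g j(2) 1
          by (simp add: m_assoc S.mem_carrier mult_inv_cancel_left)
        moreover have "x \<otimes> inv w \<in> S" using wS[OF ts(2)] A(1) by simp
        ultimately show ?thesis using ts by (auto simp: r_coset_def)
      next
        case 2
        then have ts: "t = 0" "s = 0" using j s t by auto
        have "h = (x \<otimes> b) \<otimes> (w \<otimes> g)"
          using A(1,2) g j(2) 2 by (simp add: m_assoc S.mem_carrier)
        moreover have "x \<otimes> b \<in> S" using bS[OF ts(2)] A(1) by simp
        ultimately show ?thesis using ts by (auto simp: r_coset_def)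
      qed
    next
      case B
      then obtain j :: int where "2 - t - (2 - s) = 2 * real_of_int j" and
          j2: "face_gen [^] k = face_gen [^] j"
        unfolding bdry_eq_even_shift_iff by blast
      then have j: "s - t = 2 * real_of_int j" by simp
      then have "\<bar>real_of_int j\<bar> < 1" using s t by auto
      then have "j = 0" by linarith
      moreover have "t = s" using j \<open>j = 0\<close> by simp
      ultimately show ?thesis using B(1,2) j2 g by (auto simp: r_coset_def)
    qed
  qed
  \<comment> \<open>Conversely, exponent 0 already yields the whole coset.\<close>
  have r1: "x \<otimes> g \<in> reach S s (g, bdry s)" if "x \<in> S" for x
    using reachI(1)[OF that, of "bdry s" 0 s g] g by simp
  have r2: "x \<otimes> (w \<otimes> g) \<in> reach S s (g, bdry (2 - s))" if "x \<in> S" for x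
    using reachI(2)[OF that, of "bdry (2 - s)" 0 s g] g by simp
  have "S #> g \<subseteq> reach S s (g, bdry s)" "S #> (w \<otimes> g) \<subseteq> reach S s (g, bdry (2 - s))"
    unfolding r_coset_def using r1 r2 by blast+
  then show "reach S s (g, bdry t) = (if t = s then S #> g else {})"
    and "reach S s (g, bdry (2 - t)) = (if t = s then S #> (w \<otimes> g) else {})"
    using sub1 sub2 by (cases "t = s"; simp add: subset_antisym)+
qed

text \<open>For the rule \<open>edge\<close>, both arcs belong to the edge
  \<open>w \<otimes> g\<close>, and \<open>reach_bdry\<close> evaluates to the same coset on
  them.\<close>

lemma reach_glue:
  assumes S: "subgroup S G" and s: "s \<in> {0..1}"
    and bS: "s = 0 \<Longrightarrow> b \<in> S" and wS: "s = 1 \<Longrightarrow> w \<in> S"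
    and "(p, q) \<in> glue G b w"
  shows "reach S s p = reach S s q"
  using assms(5)
proof induction
  case (rotate g z)
  then show ?case using reach_rotate[of g S s z] by (simp add: bdry_def)
next
  case (edge g t)
  then have "reach S s (w \<otimes> g, bdry t) = reach S s (g, bdry (2 - t))"
    using reach_bdry[OF S s _ _ bS wS] by simp
  then show ?case by (simp add: bdry_def)
qed auto

text \<open>The invariant for parameter \<open>s\<close> is nonempty at the first point, hence also
  at the second, which forces \<open>t = s\<close>; equality of the two cosets then places
  \<open>h\<close>.\<close>

lemma glue_bdry_imp:
  assumes S: "subgroup S G" and s: "s \<in> {0..1}" and t: "t \<in> {0..1}"
    and bS: "s = 0 \<Longrightarrow> b \<in> S" and wS: "s = 1 \<Longrightarrow> w \<in> S"
    and gl: "((g, bdry s), (h, bdry t)) \<in> glue G b w"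
  shows "t = s \<and> h \<in> S #> g"
proof -
  have gh: "g \<in> carrier G" "h \<in> carrier G" using glue_dom[OF gl] by auto
  have "S #> g = reach S s (g, bdry s)" using reach_bdry(1)[OF S s s gh(1) bS wS] by simp
  also have "\<dots> = reach S s (h, bdry t)" by (rule reach_glue[OF S s bS wS gl])
  also have "\<dots> = (if t = s then S #> h else {})" by (rule reach_bdry(1)[OF S s t gh(2) bS wS])
  finally have "S #> g = (if t = s then S #> h else {})" .
  moreover have "h \<in> S #> h" "g \<in> S #> g" using rcos_self[OF _ S] gh by auto
  ultimately show ?thesis by (metis empty_iff)
qed

lemma glue_interior_imp:
  assumes "((g, z), (h, y)) \<in> glue G b w" and "norm z < 1"
  shows "norm y < 1 \<and> (\<exists>k::int. h = face_gen [^] k \<otimes> g \<and> z = bdry (2 * real_of_int k) * y)"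
proof -
  \<comment> \<open>\<open>orb p\<close> consists of the open disc representatives that rotations
    reach from \<open>p\<close>. It is empty at boundary points, so the rule \<open>edge\<close>
    preserves it trivially.\<close>
  define orb where "orb = (\<lambda>p. {(face_gen [^] k \<otimes> fst p, y) | (k::int) y.
      norm y < 1 \<and> snd p = bdry (2 * real_of_int k) * y})"
  have "orb p = orb q" if "(p, q) \<in> glue G b w" for p q
    using that
  proof induction
    case (rotate g z)
    have z: "bdry 2 * z = bdry (2 * real_of_int (k + 1)) * y \<longleftrightarrow> z = bdry (2 * real_of_int k) * y"
      for k :: int and y
      using bdry_2_mult_eq_iff[of z k 0 y] by simp
    have f: "face_gen [^] (k + 1) \<otimes> g = face_gen [^] k \<otimes> (face_gen \<otimes> g)" for k :: int
      using rotate by (simp add: face_gen_pow_Suc(1) m_assoc)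
    let ?P = "\<lambda>c k. \<exists>y. c = (face_gen [^] k \<otimes> g, y) \<and> norm y < 1 \<and>
      bdry 2 * z = bdry (2 * real_of_int k) * y"
    have "c \<in> orb (g, bdry 2 * z) \<longleftrightarrow> (\<exists>k. ?P c k)" for c
      unfolding orb_def by auto
    moreover have "c \<in> orb (face_gen \<otimes> g, z) \<longleftrightarrow> (\<exists>k. ?P c (k + 1))" for c
      unfolding orb_def f z by auto
    ultimately have "orb (g, bdry 2 * z) = orb (face_gen \<otimes> g, z)"
      using ex_int_shift[of "?P _"] by blast
    then show ?case by (simp add: bdry_def)
  next
    case (edge g t)
    have "bdry s \<noteq> bdry r * y" if "norm y < 1" for r s y
    proof
      assume "bdry s = bdry r * y"
      then have "norm (bdry s) = norm (bdry r * y)" by simp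
      then show False using that by (simp add: norm_mult)
    qed
    then have "orb (h, bdry s) = {}" for h s by (auto simp: orb_def)
    then show ?case by (simp add: bdry_def)
  qed auto
  then have "orb (g, z) = orb (h, y)" using assms(1) by blast
  moreover have "(g, z) \<in> orb (g, z)"
  proof -
    have "g = face_gen [^] (0::int) \<otimes> g" "z = bdry (2 * real_of_int 0) * z"
      using glue_dom[OF assms(1)] by simp_all
    then show ?thesis unfolding orb_def fst_conv snd_conv using assms(2) by blast
  qed
  ultimately have "(g, z) \<in> orb (h, y)" by simp
  then obtain k :: int where k: "g = face_gen [^] k \<otimes> h" "y = bdry (2 * real_of_int k) * z"
    unfolding orb_def fst_conv snd_conv by blast
  have "h = face_gen [^] (- k) \<otimes> g"
    using k(1) glue_dom(1,2)[OF assms(1)] by (simp add: int_pow_neg inv_solve_left)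
  moreover have "z = bdry (2 * real_of_int (- k)) * y"
    unfolding k(2) by (simp add: mult.assoc[symmetric] flip: bdry_add)
  moreover have "norm y < 1" using k(2) assms(2) by (simp add: norm_mult)
  ultimately show ?thesis by blast
qed

section \<open>Coincidence and number of classes with a fixed coordinate\<close>

lemma glue_stab_iff:
  assumes u: "u \<in> canonical" and g: "g \<in> carrier G" and h: "h \<in> carrier G"
  shows "((g, u), (h, u)) \<in> glue G b w \<longleftrightarrow> h \<in> stab u #> g"
proof
  assume gl: "((g, u), (h, u)) \<in> glue G b w"
  show "h \<in> stab u #> g"
  proof (cases "norm u < 1")
    case True
    obtain k :: int where k: "h = face_gen [^] k \<otimes> g" "u = bdry (2 * real_of_int k) * u"
      using glue_interior_imp[OF gl True] by blast
    \<comment> \<open>A rotation fixing \<open>u\<close> is arbitrary at the centre; elsewhere it is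
      the identity, and then the power of \<open>face_gen\<close> is trivial too.\<close>
    have "face_gen [^] k \<in> stab u"
    proof (cases "u = 0")
      case True
      then show ?thesis using generate_pow[of face_gen] by (auto simp: stab_def)
    next
      case False
      then have "bdry (2 * real_of_int k) = 1" using k(2) by simp
      then have "face_gen [^] k = \<one>" by (simp only: bdry_even_eq_1_iff)
      then show ?thesis using subgroup.one_closed[OF stab_subgroup] by simp
    qed
    then show ?thesis using k(1) by (auto simp: r_coset_def)
  next
    case False
    then obtain s where s: "s \<in> {0..1}" "u = bdry s" using u by (auto simp: canonical_def)
    \<comment> \<open>At either vertex, \<open>stab u\<close> contains the generator that the
      invariant with \<open>S = stab u\<close> requires.\<close>
    have "s = 0 \<Longrightarrow> b \<in> stab u" "s = 1 \<Longrightarrow> w \<in> stab u"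
      using s bdry_1_neq_1 by (auto simp: stab_def intro: generate.incl)
    then show ?thesis
      using glue_bdry_imp[OF stab_subgroup s(1) s(1)] gl s(2) by blast
  qed
next
  assume "h \<in> stab u #> g"
  then obtain x where "x \<in> stab u" "h = x \<otimes> g" by (auto simp: r_coset_def)
  then show "((g, u), (h, u)) \<in> glue G b w" using glue_stab[OF u _ g] by simp
qed

lemma glue_special_points:
  assumes gl: "((g, u), (h, v)) \<in> glue G b w"
    and "u \<in> {0, bdry 0, bdry 1}" "v \<in> {0, bdry 0, bdry 1}"
  shows "u = v"
proof (cases "u = 0 \<or> v = 0")
  case True
  then have "norm u < 1 \<or> norm v < 1" by auto
  then have "norm u < 1 \<and> norm v < 1"
    using glue_interior_imp[OF gl] glue_interior_imp[OF glue.sym[OF gl]] by blast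
  then show ?thesis using assms(2,3) by auto
next
  case False
  then have "u = bdry 0 \<or> u = bdry 1" "v = bdry 0 \<or> v = bdry 1" using assms(2,3) by blast+
  moreover have "(0::real) \<in> {0..1}" "(1::real) \<in> {0..1}" by auto
  ultimately obtain s t where "s \<in> {0..1}" "t \<in> {0..1}" "u = bdry s" "v = bdry t"
    by metis
  \<comment> \<open>The full group as \<open>S\<close> makes the coset condition vacuous and leaves
    the equality of parameters.\<close>
  then show ?thesis using glue_bdry_imp[OF subgroup_self, of s t g h] gl by simp
qed

text \<open>Labels \<open>n\<close> and \<open>k\<close> give the same class exactly if
  \<open>n \<otimes> inv k\<close> lies in \<open>stab u\<close>, because \<open>g\<close> cancels
  from \<open>(n \<otimes> g) \<otimes> inv (k \<otimes> g)\<close>. Hence all fibres of the map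
  from \<open>K\<close> to classes have the size of \<open>K \<inter> stab u\<close>.\<close>

lemma card_cls_orbit:
  assumes K: "subgroup K G" and g: "g \<in> carrier G" and u: "u \<in> canonical"
  shows "card ((\<lambda>n. cls (n \<otimes> g) u) ` K) * card (K \<inter> stab u) = card K"
proof -
  interpret K: subgroup K G by fact
  interpret st: subgroup "stab u" G by (rule stab_subgroup)
  let ?F = "\<lambda>n. cls (n \<otimes> g) u"
  have finK: "finite K" using K.subset finite_carrier by (rule finite_subset)
  have u1: "u \<in> cball 0 1" using u canonical_subset by auto
  have fib: "card {n \<in> K. ?F n = ?F k} = card (K \<inter> stab u)" if k: "k \<in> K" for k
  proof -
    have "?F n = ?F k \<longleftrightarrow> n \<otimes> inv k \<in> stab u" if n: "n \<in> K" for n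
    proof -
      have "?F n = ?F k \<longleftrightarrow> ((k \<otimes> g, u), (n \<otimes> g, u)) \<in> glue G b w"
        using n k g u1 by (subst eq_commute, intro cls_eq_iff) auto
      also have "\<dots> \<longleftrightarrow> n \<otimes> g \<in> stab u #> (k \<otimes> g)"
        using n k g by (intro glue_stab_iff[OF u]) auto
      also have "\<dots> \<longleftrightarrow> (n \<otimes> g) \<otimes> inv (k \<otimes> g) \<in> stab u"
      proof -
        have "n \<otimes> g \<in> carrier G" "k \<otimes> g \<in> carrier G" using n k g by auto
        then show ?thesis
          using st.rcos_module[OF is_group] by blast
      qed
      also have "(n \<otimes> g) \<otimes> inv (k \<otimes> g) = n \<otimes> inv k"
      proof -
        have "g \<otimes> (inv g \<otimes> inv k) = inv k" using k g by (simp flip: m_assoc)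
        then show ?thesis using n k g by (simp add: inv_mult_group m_assoc)
      qed
      finally show ?thesis .
    qed
    moreover have "(n \<otimes> inv k) \<otimes> k = n" "(n \<otimes> k) \<otimes> inv k = n" if "n \<in> K" for n
      using that k by (simp_all add: m_assoc)
    ultimately have "bij_betw (\<lambda>n. n \<otimes> inv k) {n \<in> K. ?F n = ?F k} (K \<inter> stab u)"
      using k by (intro bij_betwI[where g = "\<lambda>n. n \<otimes> k"]) auto
    then show ?thesis by (rule bij_betw_same_card)
  qed
  have "card K = (\<Sum>y\<in>?F ` K. card {n \<in> K. ?F n = y})"
    using sum.image_gen[OF finK, of "\<lambda>_. 1::nat" ?F] by simp
  also have "\<dots> = (\<Sum>y\<in>?F ` K. card (K \<inter> stab u))"
    using fib by (intro sum.cong) auto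
  finally show ?thesis by simp
qed

lemma topspace_surface: "topspace (surface G b w) = {cls g z | g z. g \<in> carrier G \<and> z \<in> cball 0 1}"
  unfolding surface_def cls_def by (force simp: quotient_def)

lemma card_cls_all:
  assumes "u \<in> canonical"
  shows "card ((\<lambda>x. cls x u) ` carrier G) * card (stab u) = card (carrier G)"
proof -
  have "carrier G \<inter> stab u = stab u" using subgroup.subset[OF stab_subgroup] by blast
  moreover have "(\<lambda>n. cls (n \<otimes> \<one>) u) ` carrier G = (\<lambda>x. cls x u) ` carrier G"
    by (intro image_cong) auto
  ultimately show ?thesis using card_cls_orbit[OF subgroup_self one_closed assms] by simp
qed

lemma special_canonical: "0 \<in> canonical" "bdry 0 \<in> canonical" "bdry 1 \<in> canonical"
  unfolding canonical_def by (auto simp del: bdry_0)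

lemma card_stab:
  "card (stab 0) = face_deg" "card (stab (bdry 0)) = ord b" "card (stab (bdry 1)) = ord w"
  using bdry_1_neq_1 by (simp_all add: stab_def generate_pow_card)

lemma card_rcosets_generate:
  assumes "c \<in> carrier G"
  shows "card (rcosets (generate G {c})) * ord c = card (carrier G)"
  using lagrange[OF generate_is_subgroup[of "{c}"]] assms
  by (simp add: generate_pow_card Coset.order_def)

lemma euler_char_eq:
  "euler_char G b w = int (card (rcosets (generate G {b}))) + int (card (rcosets (generate G {w})))
     - int (card (carrier G)) + int (card (rcosets (generate G {face_gen})))"
proof -
  have fin: "finite (rcosets S)" for S
    unfolding RCOSETS_def using finite_carrier by auto
  have "card (vertices G b w) = card (rcosets (generate G {b})) + card (rcosets (generate G {w}))"
    unfolding vertices_def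
    by (subst card_Un_disjoint) (auto simp: fin card_image inj_on_def)
  moreover have "card (faces G b w) = card (rcosets (generate G {face_gen}))"
    unfolding faces_def by (auto simp: card_image inj_on_def)
  ultimately show ?thesis unfolding euler_char_def edges_def by simp
qed

end

subsection \<open>The projection to the quotient dessin\<close>

locale dessin_quotient = dessin G b w for G (structure) and b w +
  fixes N :: "'a set"
  assumes normal_N: "N \<lhd> G"
begin

sublocale N: normal N G by (rule normal_N)

text \<open>Everything proved for a dessin becomes available downstairs under the prefix
  \<open>Q\<close>.\<close>

sublocale Q: dessin "G Mod N" "N #> b" "N #> w"
proof -
  interpret Q: group "G Mod N" by (rule N.factorgroup_is_group)
  show "dessin (G Mod N) (N #> b) (N #> w)"
    by unfold_locales (auto simp: FactGroup_def RCOSETS_def finite_carrier)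
qed

text \<open>Keeps products in the quotient as group products, so that \<open>coset_mult\<close> can
  compute them on representatives.\<close>

declare mult_FactGroup [simp del]

text \<open>The exponent of the projection on face discs, hence its local degree at a face
  centre.\<close>

definition face_ram :: nat where "face_ram = card (generate G {face_gen} \<inter> N)"

lemma coset_closed [simp]: "g \<in> carrier G \<Longrightarrow> N #> g \<in> carrier (G Mod N)"
  by (auto simp: FactGroup_def RCOSETS_def)

lemma carrier_quotientE:
  assumes "x \<in> carrier (G Mod N)"
  obtains g where "g \<in> carrier G" "x = N #> g"
  using assms by (auto simp: FactGroup_def RCOSETS_def)

lemma coset_mult:
  "g \<in> carrier G \<Longrightarrow> h \<in> carrier G \<Longrightarrow>
    (N #> g) \<otimes>\<^bsub>G Mod N\<^esub> (N #> h) = N #> (g \<otimes> h)"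
  by (simp add: FactGroup_def N.rcos_sum)

lemma quotient_face_gen: "(N #> b) \<otimes>\<^bsub>G Mod N\<^esub> (N #> w) = N #> face_gen"
  by (simp add: coset_mult)

lemma coset_cong:
  assumes "N #> g = N #> h" "a \<in> carrier G" "g \<in> carrier G" "h \<in> carrier G"
  shows "N #> (a \<otimes> g) = N #> (a \<otimes> h)"
  using assms by (metis coset_mult)

lemma coset_eq_iff:
  assumes "g \<in> carrier G" "h \<in> carrier G"
  shows "N #> h = N #> g \<longleftrightarrow> (\<exists>n\<in>N. h = n \<otimes> g)"
proof
  assume "N #> h = N #> g"
  then have "h \<in> N #> g" using rcos_self[OF assms(2) N.is_subgroup] by simp
  then show "\<exists>n\<in>N. h = n \<otimes> g" by (auto simp: r_coset_def)
next
  assume "\<exists>n\<in>N. h = n \<otimes> g"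
  then have "h \<in> N #> g" by (auto simp: r_coset_def)
  then show "N #> h = N #> g" using repr_independence[OF _ assms(1) N.is_subgroup] by simp
qed

section \<open>Effect of the projection on coordinates\<close>

lemma face_deg_eq: "face_deg = face_ram * Q.face_deg"
  unfolding face_ram_def quotient_face_gen
  by (rule ord_eq_card_Int_mult_ord_FactGroup[OF finite_carrier normal_N]) simp

lemma face_ram_pos: "face_ram > 0"
  using face_deg_pos face_deg_eq by (metis mult_is_0 neq0_conv)

text \<open>Raising to the power \<open>face_ram\<close> cancels that factor of
  \<open>face_deg\<close>, so the position along a walk, counted in edges, is preserved.\<close>

lemma bdry_power: "bdry s ^ face_ram = Q.bdry s"
  using face_ram_pos by (simp add: bdry_def Q.bdry_def Complex.DeMoivre face_deg_eq)

lemma face_gen_pow_in_N: "face_gen [^] (int Q.face_deg * k) \<in> N"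
proof -
  have hom: "(\<lambda>a. N #> a) \<in> hom G (G Mod N)" by (rule N.r_coset_hom_Mod)
  have "N #> (face_gen [^] (int Q.face_deg * k)) = (N #> face_gen) [^]\<^bsub>G Mod N\<^esub> (int Q.face_deg * k)"
    by (rule hom_int_pow[OF hom _ is_group Q.is_group]) simp
  also have "\<dots> = \<one>\<^bsub>G Mod N\<^esub>"
  proof -
    have "int (Q.ord (N #> face_gen)) dvd int Q.face_deg * k" unfolding quotient_face_gen by simp
    then show ?thesis using Q.int_pow_eq_id[of "N #> face_gen"] by (simp del: one_FactGroup)
  qed
  also have "\<dots> = N" by (simp add: FactGroup_def)
  finally show ?thesis using coset_join1[OF _ _ N.is_subgroup] by simp
qed

text \<open>Nonzero coordinates with equal power differ by a root of unity. The corresponding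
  rotation multiplies the label by a power of \<open>face_gen\<close> whose exponent is a multiple
  of the degree downstairs, hence by an element of \<open>N\<close>.\<close>

lemma glue_same_power:
  assumes h: "h \<in> carrier G" and u: "u \<in> cball 0 1" and v: "v \<in> cball 0 1"
    and eq: "u ^ face_ram = v ^ face_ram"
  shows "\<exists>n\<in>N. ((h, u), (n \<otimes> h, v)) \<in> glue G b w"
proof (cases "v = 0")
  case True
  then have "u ^ face_ram = 0" using eq face_ram_pos by (simp add: zero_power)
  then have "u = 0" by simp
  then show ?thesis using True h
    by (intro bexI[of _ \<one>]) (auto intro: glue.refl)
next
  case False
  then have "(u / v) ^ face_ram = 1" using eq by (simp add: power_divide)
  then obtain k where k: "u / v = cis (2 * pi * real k / real face_ram)"
    using bij_betw_imp_surj_on[OF Complex.bij_betw_roots_unity[OF face_ram_pos]] by blast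
  let ?j = "int Q.face_deg * int k"
  have "u / v = bdry (2 * real_of_int ?j)"
    unfolding k bdry_def face_deg_eq using Q.face_deg_pos by (simp add: field_simps)
  then have "u = bdry (2 * real_of_int ?j) * v" using False by (simp add: field_simps)
  then have "((h, u), (face_gen [^] ?j \<otimes> h, v)) \<in> glue G b w"
    using glue_rotate_pow[OF h v, of ?j] by (simp only:)
  then show ?thesis using face_gen_pow_in_N by blast
qed

section \<open>Lifting of gluing steps\<close>

abbreviation lift where "lift \<equiv> lifted_projection G b w N"

lemma lift_eq: "lift (g, z) = (N #> g, z ^ face_ram)"
  by (simp add: lifted_projection_def face_ram_def)

text \<open>The lift must exist from every preimage of \<open>p'\<close>: only then do lifts
  compose, since the end of a lifted step is some preimage, not a chosen one.\<close>

definition lifts :: "'a set \<times> complex \<Rightarrow> 'a set \<times> complex \<Rightarrow> bool" where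
  "lifts p' q' \<longleftrightarrow> (\<forall>h u. h \<in> carrier G \<longrightarrow> u \<in> cball 0 1 \<longrightarrow> lift (h, u) = p' \<longrightarrow>
     (\<exists>q. ((h, u), q) \<in> glue G b w \<and> lift q = q'))"

text \<open>Each generating step downstairs is imitated upstairs from a suitable representative.
  Both directions go through the induction together, which settles the rule
  \<open>sym\<close>.\<close>

lemma glue_lifts:
  assumes "(p', q') \<in> glue (G Mod N) (N #> b) (N #> w)"
  shows "lifts p' q' \<and> lifts q' p'"
  using assms
proof induction
  case (refl x z)
  then show ?case unfolding lifts_def by (blast intro: glue.refl)
next
  case (sym p q)
  then show ?case by blast
next
  case (trans p q r)
  have lifts_trans: "lifts p r" if "lifts p q" "lifts q r" for p q r
    unfolding lifts_def
  proof (intro allI impI)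
    fix h u assume "h \<in> carrier G" "u \<in> cball 0 1" "lift (h, u) = p"
    then obtain c where c: "((h, u), c) \<in> glue G b w" "lift c = q"
      using \<open>lifts p q\<close> unfolding lifts_def by blast
    obtain h2 u2 where c2: "c = (h2, u2)" by (cases c)
    have "h2 \<in> carrier G" "u2 \<in> cball 0 1" using glue_dom[OF c(1)[unfolded c2]] by auto
    then obtain d where "(c, d) \<in> glue G b w" "lift d = r"
      using \<open>lifts q r\<close> c(2) unfolding lifts_def c2 by blast
    then show "\<exists>d. ((h, u), d) \<in> glue G b w \<and> lift d = r"
      using glue.trans[OF c(1)] by blast
  qed
  show ?case
    using lifts_trans[of p q r] lifts_trans[of r q p] trans.IH by simp
next
  case (rotate x z)
  then obtain g where g: "g \<in> carrier G" "x = N #> g" using carrier_quotientE by blast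
  have rot: "cis (2 * pi / real Q.face_deg) = Q.bdry 2" by (simp add: Q.bdry_def)
  have x: "(N #> b) \<otimes>\<^bsub>G Mod N\<^esub> (N #> w) \<otimes>\<^bsub>G Mod N\<^esub> x = N #> (face_gen \<otimes> g)"
    unfolding g(2) quotient_face_gen using g by (simp add: coset_mult)
  have "lifts (x, Q.bdry 2 * z) (N #> (face_gen \<otimes> g), z)"
    unfolding lifts_def
  proof (intro allI impI)
    fix h u assume h: "h \<in> carrier G" and u: "u \<in> cball 0 1" and "lift (h, u) = (x, Q.bdry 2 * z)"
    then have L: "N #> h = N #> g" "u ^ face_ram = Q.bdry 2 * z" by (auto simp: lift_eq g)
    \<comment> \<open>Writing \<open>u\<close> as a rotated coordinate makes the rule applicable at
      \<open>h\<close>; the power \<open>face_ram\<close> turns \<open>bdry (-2)\<close> into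
      \<open>Q.bdry (-2)\<close>.\<close>
    have "((h, bdry 2 * (bdry (-2) * u)), (face_gen \<otimes> h, bdry (-2) * u)) \<in> glue G b w"
      using h u by (intro glue_rotate) (auto simp: norm_mult)
    moreover have "bdry 2 * (bdry (-2) * u) = u" by (simp flip: bdry_add mult.assoc)
    moreover have "(bdry (-2) * u) ^ face_ram = z"
      unfolding power_mult_distrib L(2) bdry_power by (simp flip: Q.bdry_add mult.assoc)
    moreover have "N #> (face_gen \<otimes> h) = N #> (face_gen \<otimes> g)"
      using L(1) h g by (intro coset_cong) auto
    ultimately have "((h, u), (face_gen \<otimes> h, bdry (-2) * u)) \<in> glue G b w"
      "lift (face_gen \<otimes> h, bdry (-2) * u) = (N #> (face_gen \<otimes> g), z)"
      by (simp_all add: lift_eq)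
    then show "\<exists>q. ((h, u), q) \<in> glue G b w \<and> lift q = (N #> (face_gen \<otimes> g), z)" by blast
  qed
  moreover have "lifts (N #> (face_gen \<otimes> g), z) (x, Q.bdry 2 * z)"
    unfolding lifts_def
  proof (intro allI impI)
    fix h u assume h: "h \<in> carrier G" and u: "u \<in> cball 0 1"
      and "lift (h, u) = (N #> (face_gen \<otimes> g), z)"
    then have L: "N #> h = N #> (face_gen \<otimes> g)" "u ^ face_ram = z" by (auto simp: lift_eq)
    \<comment> \<open>Read backwards, the rotation must end at \<open>h\<close>, hence it starts at
      this label.\<close>
    let ?h = "inv face_gen \<otimes> h"
    have "((?h, bdry 2 * u), (face_gen \<otimes> ?h, u)) \<in> glue G b w"
      using h u by (intro glue_rotate) auto
    moreover have "face_gen \<otimes> ?h = h" using h by (intro mult_inv_cancel_left) auto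
    moreover have "N #> ?h = x"
    proof -
      have "N #> ?h = N #> (inv face_gen \<otimes> (face_gen \<otimes> g))"
        using L(1) h g by (intro coset_cong) auto
      also have "inv face_gen \<otimes> (face_gen \<otimes> g) = g"
        using g by (intro mult_inv_cancel_left) auto
      finally show ?thesis using g by simp
    qed
    moreover have "(bdry 2 * u) ^ face_ram = Q.bdry 2 * z"
      unfolding power_mult_distrib L(2) bdry_power ..
    ultimately have "((h, u), (?h, bdry 2 * u)) \<in> glue G b w" "lift (?h, bdry 2 * u) = (x, Q.bdry 2 * z)"
      by (auto simp: lift_eq intro: glue.sym)
    then show "\<exists>q. ((h, u), q) \<in> glue G b w \<and> lift q = (x, Q.bdry 2 * z)" by blast
  qed
  ultimately show ?case unfolding rot x by blast
next
  case (edge x t)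
  then obtain g where g: "g \<in> carrier G" "x = N #> g" using carrier_quotientE by blast
  have rot: "cis (t * pi / real Q.face_deg) = Q.bdry t"
    "cis ((2 - t) * pi / real Q.face_deg) = Q.bdry (2 - t)" by (simp_all add: Q.bdry_def)
  have x: "(N #> w) \<otimes>\<^bsub>G Mod N\<^esub> x = N #> (w \<otimes> g)"
    unfolding g(2) using g by (simp add: coset_mult)
  have Nn: "N #> (n \<otimes> h) = N #> h" if "n \<in> N" "h \<in> carrier G" for n h
    using coset_eq_iff[of h "n \<otimes> h"] that by auto
  have "lifts (N #> (w \<otimes> g), Q.bdry t) (x, Q.bdry (2 - t))"
    unfolding lifts_def
  proof (intro allI impI)
    fix h u assume h: "h \<in> carrier G" and u: "u \<in> cball 0 1"
      and "lift (h, u) = (N #> (w \<otimes> g), Q.bdry t)"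
    then have L: "N #> h = N #> (w \<otimes> g)" "u ^ face_ram = bdry t ^ face_ram"
      by (auto simp: lift_eq bdry_power)
    \<comment> \<open>\<open>u\<close> lies over the right point but possibly on another arc of the
      same walk. A factor from \<open>N\<close>, invisible downstairs, moves it to
      \<open>bdry t\<close>, where the rule \<open>edge\<close> applies.\<close>
    then obtain n where n: "n \<in> N" "((h, u), (n \<otimes> h, bdry t)) \<in> glue G b w"
      using glue_same_power[OF h u, of "bdry t"] by auto
    let ?h = "inv w \<otimes> (n \<otimes> h)"
    have nh: "n \<otimes> h \<in> carrier G" using n h by simp
    have "((w \<otimes> ?h, bdry t), (?h, bdry (2 - t))) \<in> glue G b w"
      using nh edge by (intro glue_edge) auto
    moreover have "w \<otimes> ?h = n \<otimes> h" using nh by (intro mult_inv_cancel_left) auto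
    moreover have "N #> ?h = x"
    proof -
      have "N #> ?h = N #> (inv w \<otimes> (w \<otimes> g))"
        using L(1) Nn[OF n(1) h] nh g by (intro coset_cong) auto
      also have "inv w \<otimes> (w \<otimes> g) = g" using g by (intro mult_inv_cancel_left) auto
      finally show ?thesis using g by simp
    qed
    ultimately have "((h, u), (?h, bdry (2 - t))) \<in> glue G b w"
      "lift (?h, bdry (2 - t)) = (x, Q.bdry (2 - t))"
      using n(2) by (auto simp: lift_eq bdry_power intro: glue.trans)
    then show "\<exists>q. ((h, u), q) \<in> glue G b w \<and> lift q = (x, Q.bdry (2 - t))" by blast
  qed
  moreover have "lifts (x, Q.bdry (2 - t)) (N #> (w \<otimes> g), Q.bdry t)"
    unfolding lifts_def
  proof (intro allI impI)
    fix h u assume h: "h \<in> carrier G" and u: "u \<in> cball 0 1"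
      and "lift (h, u) = (x, Q.bdry (2 - t))"
    then have L: "N #> h = N #> g" "u ^ face_ram = bdry (2 - t) ^ face_ram"
      by (auto simp: lift_eq bdry_power g)
    then obtain n where n: "n \<in> N" "((h, u), (n \<otimes> h, bdry (2 - t))) \<in> glue G b w"
      using glue_same_power[OF h u, of "bdry (2 - t)"] by auto
    have nh: "n \<otimes> h \<in> carrier G" using n h by simp
    have "((w \<otimes> (n \<otimes> h), bdry t), (n \<otimes> h, bdry (2 - t))) \<in> glue G b w"
      using nh edge by (intro glue_edge) auto
    then have "((h, u), (w \<otimes> (n \<otimes> h), bdry t)) \<in> glue G b w"
      using n(2) by (blast intro: glue.trans glue.sym)
    moreover have "N #> (w \<otimes> (n \<otimes> h)) = N #> (w \<otimes> g)"
      using L(1) Nn[OF n(1) h] nh g by (intro coset_cong) auto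
    then have "lift (w \<otimes> (n \<otimes> h), bdry t) = (N #> (w \<otimes> g), Q.bdry t)"
      by (simp add: lift_eq bdry_power)
    ultimately show "\<exists>q. ((h, u), q) \<in> glue G b w \<and> lift q = (N #> (w \<otimes> g), Q.bdry t)"
      by blast
  qed
  ultimately show ?case unfolding rot x by blast
qed

section \<open>Continuity and fibres of the projection\<close>

abbreviation proj where "proj \<equiv> natural_projection G b w N"
abbreviation quotient_surface where "quotient_surface \<equiv> surface (G Mod N) (N #> b) (N #> w)"

lemma proj_cls:
  assumes "g \<in> carrier G" "z \<in> cball 0 1"
  shows "proj (cls g z) = Q.cls (N #> g) (z ^ face_ram)"
  unfolding cls_def Q.cls_def
  using natural_projection_class[OF is_group finite_carrier b_closed w_closed normal_N, of "(g, z)"]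
    assms by (simp add: lift_eq)

lemma power_face_ram_in_cball: "z \<in> cball 0 1 \<Longrightarrow> z ^ face_ram \<in> (cball 0 1 :: complex set)"
  by (simp add: norm_power power_le_one)

lemma continuous_map_lift:
  "continuous_map (prod_topology (discrete_topology (carrier G)) (top_of_set (cball 0 1)))
     (prod_topology (discrete_topology (carrier (G Mod N))) (top_of_set (cball 0 1))) lift"
proof -
  have "continuous_map (discrete_topology (carrier G)) (discrete_topology (carrier (G Mod N))) (\<lambda>g. N #> g)"
    by simp
  moreover have "continuous_map (top_of_set (cball 0 1)) (top_of_set (cball 0 1))
      (\<lambda>z::complex. z ^ face_ram)"
    using power_face_ram_in_cball by (auto intro!: continuous_intros)
  ultimately show ?thesis
    unfolding lifted_projection_def face_ram_def[symmetric] by (subst continuous_map_prod_top) simp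
qed

text \<open>Openness is tested on the disjoint discs, where the projection is represented by
  \<open>lift\<close>: the set to be tested is the preimage under \<open>lift\<close> of the open
  set that \<open>U\<close> determines downstairs.\<close>

lemma continuous_map_proj: "continuous_map (surface G b w) quotient_surface proj"
  unfolding continuous_map_def
proof (intro conjI allI impI)
  show "proj \<in> topspace (surface G b w) \<rightarrow> topspace quotient_surface"
    unfolding topspace_surface Q.topspace_surface
    using proj_cls power_face_ram_in_cball coset_closed by fastforce
next
  fix U assume "openin quotient_surface U"
  then have U: "openin (prod_topology (discrete_topology (carrier (G Mod N))) (top_of_set (cball 0 1)))
      {p \<in> carrier (G Mod N) \<times> cball 0 1. glue (G Mod N) (N #> b) (N #> w) `` {p} \<in> U}"
    unfolding surface_def openin_quotient_topology by simp
  let ?V = "{x \<in> topspace (surface G b w). proj x \<in> U}"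
  have "{p \<in> carrier G \<times> cball 0 1. glue G b w `` {p} \<in> ?V} =
      {p \<in> carrier G \<times> cball 0 1.
        lift p \<in> {p \<in> carrier (G Mod N) \<times> cball 0 1. glue (G Mod N) (N #> b) (N #> w) `` {p} \<in> U}}"
    (is "?A = ?B")
  proof -
    have "(g, z) \<in> ?A \<longleftrightarrow> (g, z) \<in> ?B" for g z
    proof (cases "g \<in> carrier G \<and> z \<in> cball 0 1")
      case True
      then have "cls g z \<in> topspace (surface G b w)" unfolding topspace_surface by blast
      moreover have "lift (g, z) \<in> carrier (G Mod N) \<times> cball 0 1"
        using True power_face_ram_in_cball by (simp add: lift_eq)
      ultimately show ?thesis
        using True proj_cls[of g z] by (simp add: lift_eq flip: cls_def Q.cls_def)
    qed auto
    then show ?thesis unfolding set_eq_iff split_paired_All by (intro allI)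
  qed
  moreover have "openin (prod_topology (discrete_topology (carrier G)) (top_of_set (cball 0 1))) ?B"
    using openin_continuous_map_preimage[OF continuous_map_lift U] by simp
  moreover have "?V \<subseteq> topspace (surface G b w)" by blast
  ultimately show "openin (surface G b w) ?V"
    unfolding surface_def openin_quotient_topology topspace_quotient_topology by simp
qed

text \<open>The gluing of two images lifts to a gluing of \<open>(h, z)\<close> with a point whose
  label lies in \<open>N #> g\<close> and whose coordinate has the same power as \<open>u\<close>; a
  second factor from \<open>N\<close> turns that coordinate into \<open>u\<close>.\<close>

lemma fibre_proj:
  assumes g: "g \<in> carrier G" and u: "u \<in> cball 0 1"
  shows "fibre (surface G b w) proj (Q.cls (N #> g) (u ^ face_ram)) = (\<lambda>n. cls (n \<otimes> g) u) ` N"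
    (is "?F = ?I")
proof (intro equalityI subsetI)
  fix x assume "x \<in> ?F"
  then obtain h z where h: "h \<in> carrier G" and z: "z \<in> cball 0 1" and x: "x = cls h z"
    and "proj x = Q.cls (N #> g) (u ^ face_ram)"
    unfolding fibre_def topspace_surface by blast
  then have "Q.cls (N #> h) (z ^ face_ram) = Q.cls (N #> g) (u ^ face_ram)" by (simp add: proj_cls)
  then have "(lift (h, z), lift (g, u)) \<in> glue (G Mod N) (N #> b) (N #> w)"
    unfolding lift_eq
    using Q.cls_eq_iff[OF coset_closed[OF h] coset_closed[OF g]] power_face_ram_in_cball z u by blast
  then obtain q where q: "((h, z), q) \<in> glue G b w" "lift q = lift (g, u)"
    using glue_lifts h z unfolding lifts_def by blast
  obtain k v where kv: "q = (k, v)" by (cases q)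
  have k: "k \<in> carrier G" and v: "v \<in> cball 0 1" using glue_dom[OF q(1)[unfolded kv]] by auto
  have "N #> k = N #> g" "v ^ face_ram = u ^ face_ram" using q(2) by (auto simp: kv lift_eq)
  then obtain n1 n2 where n: "n1 \<in> N" "n2 \<in> N" "k = n1 \<otimes> g" "((k, v), (n2 \<otimes> k, u)) \<in> glue G b w"
    using coset_eq_iff[OF g k] glue_same_power[OF k v u] by blast
  have "((h, z), (n2 \<otimes> k, u)) \<in> glue G b w" using q(1) n(4) unfolding kv by (rule glue.trans)
  moreover have "n2 \<otimes> k = (n2 \<otimes> n1) \<otimes> g" using n g by (simp add: m_assoc)
  ultimately have "((h, z), ((n2 \<otimes> n1) \<otimes> g, u)) \<in> glue G b w" by simp
  then have "x = cls ((n2 \<otimes> n1) \<otimes> g) u"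
    unfolding x using h z u n(1,2) g by (subst cls_eq_iff) auto
  then show "x \<in> ?I" using n(1,2) by blast
next
  fix x assume "x \<in> ?I"
  then obtain n where n: "n \<in> N" "x = cls (n \<otimes> g) u" by blast
  have ng: "n \<otimes> g \<in> carrier G" using n(1) g by simp
  have "N #> (n \<otimes> g) = N #> g" using coset_eq_iff[OF g ng] n(1) by blast
  then have "proj x = Q.cls (N #> g) (u ^ face_ram)" using proj_cls[OF ng u] n(2) by simp
  moreover have "x \<in> topspace (surface G b w)" unfolding topspace_surface using n(2) ng u by blast
  ultimately show "x \<in> ?F" by (simp add: fibre_def)
qed

lemma card_fibre_proj:
  assumes g: "g \<in> carrier G" and u: "u \<in> canonical"
  shows "finite (fibre (surface G b w) proj (Q.cls (N #> g) (u ^ face_ram)))"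
    and "card (fibre (surface G b w) proj (Q.cls (N #> g) (u ^ face_ram))) * card (N \<inter> stab u) = card N"
proof -
  have u1: "u \<in> cball 0 1" using u canonical_subset by blast
  have "finite N" using N.subset finite_carrier by (rule finite_subset)
  then show "finite (fibre (surface G b w) proj (Q.cls (N #> g) (u ^ face_ram)))"
    unfolding fibre_proj[OF g u1] by simp
  show "card (fibre (surface G b w) proj (Q.cls (N #> g) (u ^ face_ram))) * card (N \<inter> stab u) = card N"
    unfolding fibre_proj[OF g u1] by (rule card_cls_orbit[OF N.is_subgroup g u])
qed

lemma card_Int_N_eq_1_iff:
  assumes "subgroup S G"
  shows "card (S \<inter> N) = 1 \<longleftrightarrow> S \<inter> N = {\<one>}"
proof
  assume "card (S \<inter> N) = 1"
  then obtain x where x: "S \<inter> N = {x}" by (rule card_1_singletonE)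
  moreover have "\<one> \<in> S \<inter> N" using N.one_closed subgroup.one_closed[OF assms] by blast
  ultimately show "S \<inter> N = {\<one>}" by simp
qed simp

lemma card_fibre_eq_iff:
  assumes g: "g \<in> carrier G" and u: "u \<in> canonical"
  shows "card (fibre (surface G b w) proj (Q.cls (N #> g) (u ^ face_ram))) = card N
          \<longleftrightarrow> stab u \<inter> N = {\<one>}"
    and "card (fibre (surface G b w) proj (Q.cls (N #> g) (u ^ face_ram))) < card N
          \<longleftrightarrow> stab u \<inter> N \<noteq> {\<one>}"
proof -
  let ?c = "card (fibre (surface G b w) proj (Q.cls (N #> g) (u ^ face_ram)))"
  have "finite N" using N.subset finite_carrier by (rule finite_subset)
  then have N0: "card N > 0" using N.one_closed card_gt_0_iff by blast
  have eq: "?c * card (N \<inter> stab u) = card N" by (rule card_fibre_proj(2)[OF g u])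
  let ?d = "card (N \<inter> stab u)"
  have c0: "?c \<noteq> 0" and d0: "?d \<noteq> 0" using N0 eq by (metis mult_is_0 less_irrefl)+
  have "?c = card N \<longleftrightarrow> ?d = 1"
    using eq c0 by (metis mult_cancel1 mult.right_neutral)
  moreover have "?c \<le> card N"
    using d0 unfolding eq[symmetric] by simp
  ultimately have "?c = card N \<longleftrightarrow> ?d = 1" "?c < card N \<longleftrightarrow> ?d \<noteq> 1"
    by linarith+
  then show "?c = card N \<longleftrightarrow> stab u \<inter> N = {\<one>}" "?c < card N \<longleftrightarrow> stab u \<inter> N \<noteq> {\<one>}"
    using card_Int_N_eq_1_iff[OF stab_subgroup, of u] by (simp_all add: Int_commute)
qed

section \<open>Ramification points and their number\<close>

lemma quotient_surface_cases:
  assumes "y \<in> topspace quotient_surface"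
  obtains g u where "g \<in> carrier G" "u \<in> canonical" "y = Q.cls (N #> g) (u ^ face_ram)"
proof -
  obtain h \<zeta> where h: "h \<in> carrier G" and \<zeta>: "\<zeta> \<in> cball 0 1" and y: "y = Q.cls (N #> h) \<zeta>"
    using assms carrier_quotientE unfolding Q.topspace_surface by blast
  \<comment> \<open>Taking a root first lets the move to a canonical coordinate happen upstairs,
    where \<open>stab\<close> controls the fibre.\<close>
  obtain z where z: "\<zeta> = z ^ face_ram" using face_ram_pos exists_complex_root by blast
  have z1: "z \<in> cball 0 1"
    using \<zeta> face_ram_pos by (simp add: z norm_power power_le_one_iff)
  obtain g u where gu: "g \<in> carrier G" "u \<in> canonical" "((h, z), (g, u)) \<in> glue G b w"
    using ex_canonical[OF h z1] by blast
  have u1: "u \<in> cball 0 1" using gu(2) canonical_subset by blast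
  have "cls h z = cls g u" using cls_eq_iff[OF h gu(1) z1 u1] gu(3) by simp
  then have "y = Q.cls (N #> g) (u ^ face_ram)"
    using proj_cls[OF h z1] proj_cls[OF gu(1) u1] y z by simp
  then show thesis using that gu by blast
qed

text \<open>The size of a fibre depends on the coordinate \<open>u\<close> but not on the label, so
  the images of the points with coordinate \<open>u\<close> ramify all together or not at
  all.\<close>

definition ram_part :: "complex \<Rightarrow> ('a set \<times> complex) set set" where
  "ram_part u = (if stab u \<inter> N = {\<one>} then {} else (\<lambda>x. Q.cls x (u ^ face_ram)) ` carrier (G Mod N))"

lemma special_power:
  "0 ^ face_ram = (0::complex)" "bdry 0 ^ face_ram = Q.bdry 0" "bdry 1 ^ face_ram = Q.bdry 1"
  using face_ram_pos by (simp_all only: bdry_power zero_power)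

lemma stab_Int_N_nontrivial:
  assumes "stab u \<inter> N \<noteq> {\<one>}"
  shows "u \<in> {0, bdry 0, bdry 1}"
proof (rule ccontr)
  assume "u \<notin> {0, bdry 0, bdry 1}"
  then have "stab u = {\<one>}" by (simp add: stab_def)
  then show False using assms N.one_closed by simp
qed

text \<open>A fibre is deficient exactly if \<open>stab u\<close> meets \<open>N\<close>
  nontrivially, and \<open>stab u\<close> itself is trivial away from face centres and
  vertices.\<close>

lemma ramification_points_proj:
  "ramification_points (card N) (surface G b w) quotient_surface proj =
     ram_part 0 \<union> ram_part (bdry 0) \<union> ram_part (bdry 1)" (is "?R = ?P")
proof (intro equalityI subsetI)
  fix y assume "y \<in> ?R"
  then have y: "y \<in> topspace quotient_surface" "card (fibre (surface G b w) proj y) < card N"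
    unfolding ramification_points_def by auto
  obtain g u where gu: "g \<in> carrier G" "u \<in> canonical" "y = Q.cls (N #> g) (u ^ face_ram)"
    using y(1) by (rule quotient_surface_cases)
  have nt: "stab u \<inter> N \<noteq> {\<one>}" using card_fibre_eq_iff(2)[OF gu(1,2)] y(2) gu(3) by simp
  then have "y \<in> ram_part u" unfolding ram_part_def using gu by simp
  then show "y \<in> ?P" using stab_Int_N_nontrivial[OF nt] by blast
next
  fix y assume "y \<in> ?P"
  then obtain u where u: "y \<in> ram_part u" "u \<in> canonical" using special_canonical by blast
  have nt: "stab u \<inter> N \<noteq> {\<one>}" using u(1) by (auto simp: ram_part_def split: if_splits)
  then obtain x where x: "x \<in> carrier (G Mod N)" "y = Q.cls x (u ^ face_ram)"
    using u(1) unfolding ram_part_def by auto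
  obtain g where g: "g \<in> carrier G" "x = N #> g" using carrier_quotientE[OF x(1)] by blast
  have u1: "u \<in> cball 0 1" using u(2) canonical_subset by blast
  have "y \<in> topspace quotient_surface"
    unfolding Q.topspace_surface using x power_face_ram_in_cball[OF u1] by blast
  then show "y \<in> ?R"
    unfolding ramification_points_def
    using card_fibre_proj(1)[OF g(1) u(2)] card_fibre_eq_iff(2)[OF g(1) u(2)] nt x(2) g(2) by simp
qed

lemma finite_ram_part: "finite (ram_part u)"
  unfolding ram_part_def using Q.finite_carrier by simp

text \<open>A common point would glue two different special coordinates downstairs.\<close>

lemma ram_part_disjoint:
  assumes "u ^ face_ram \<noteq> v ^ face_ram"
    and "u \<in> {0, bdry 0, bdry 1}" "v \<in> {0, bdry 0, bdry 1}"
  shows "ram_part u \<inter> ram_part v = {}"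
proof (rule ccontr)
  assume "ram_part u \<inter> ram_part v \<noteq> {}"
  then obtain y where "y \<in> ram_part u" "y \<in> ram_part v" by blast
  then obtain x1 x2 where x: "x1 \<in> carrier (G Mod N)" "x2 \<in> carrier (G Mod N)"
    "y = Q.cls x1 (u ^ face_ram)" "y = Q.cls x2 (v ^ face_ram)"
    unfolding ram_part_def by (auto split: if_splits)
  have special: "c ^ face_ram \<in> {0, Q.bdry 0, Q.bdry 1}" if "c \<in> {0, bdry 0, bdry 1}" for c
    using that special_power by blast
  have uv: "u \<in> cball 0 1" "v \<in> cball 0 1"
    using assms(2,3) special_canonical canonical_subset by blast+
  have "Q.cls x1 (u ^ face_ram) = Q.cls x2 (v ^ face_ram)" using x(3,4) by simp
  then have "((x1, u ^ face_ram), (x2, v ^ face_ram)) \<in> glue (G Mod N) (N #> b) (N #> w)"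
    by (simp only: Q.cls_eq_iff[OF x(1,2) uv[THEN power_face_ram_in_cball]])
  then have "u ^ face_ram = v ^ face_ram"
    by (rule Q.glue_special_points) (rule special, fact)+
  then show False using assms(1) by simp
qed

text \<open>The class count for the quotient dessin; the stabiliser downstairs supplies the
  denominator.\<close>

lemma card_ram_part:
  assumes "u ^ face_ram \<in> Q.canonical"
  shows "real (card (ram_part u)) = real (card (carrier (G Mod N))) *
    (real (if stab u \<inter> N = {\<one>} then 0 else 1) / real (card (Q.stab (u ^ face_ram))))"
proof -
  have "card ((\<lambda>x. Q.cls x (u ^ face_ram)) ` carrier (G Mod N)) * card (Q.stab (u ^ face_ram))
      = card (carrier (G Mod N))"
    by (rule Q.card_cls_all[OF assms])
  moreover have "card (carrier (G Mod N)) \<noteq> 0"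
    using Q.finite_carrier Q.one_closed by (metis card_eq_0_iff empty_iff)
  ultimately have "card (Q.stab (u ^ face_ram)) \<noteq> 0"
    and "real (card ((\<lambda>x. Q.cls x (u ^ face_ram)) ` carrier (G Mod N))) *
      real (card (Q.stab (u ^ face_ram))) = real (card (carrier (G Mod N)))"
    by (metis mult_is_0, metis of_nat_mult)
  then show ?thesis by (simp add: ram_part_def field_simps)
qed

lemma card_ramification_points:
  "real (card (ramification_points (card N) (surface G b w) quotient_surface proj)) =
     real (card (carrier (G Mod N))) *
       (real (if generate G {b} \<inter> N = {\<one>} then 0 else 1) / real (Q.ord (N #> b))
        + real (if generate G {w} \<inter> N = {\<one>} then 0 else 1) / real (Q.ord (N #> w))
        + real (if generate G {face_gen} \<inter> N = {\<one>} then 0 else 1) / real Q.face_deg)"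
proof -
  have d1: "(0::complex) ^ face_ram \<noteq> bdry 0 ^ face_ram"
    and d2: "(0::complex) ^ face_ram \<noteq> bdry 1 ^ face_ram"
    and d3: "bdry 0 ^ face_ram \<noteq> bdry 1 ^ face_ram"
    unfolding special_power using Q.bdry_1_neq_1 Q.bdry_nonzero by (auto simp: eq_commute[of _ "Q.bdry 1"])
  have "ram_part 0 \<inter> ram_part (bdry 0) = {}" "ram_part 0 \<inter> ram_part (bdry 1) = {}"
    "ram_part (bdry 0) \<inter> ram_part (bdry 1) = {}"
    using ram_part_disjoint[OF d1] ram_part_disjoint[OF d2] ram_part_disjoint[OF d3] by blast+
  then have "card (ram_part 0 \<union> ram_part (bdry 0) \<union> ram_part (bdry 1)) =
      card (ram_part 0) + card (ram_part (bdry 0)) + card (ram_part (bdry 1))"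
    by (simp add: card_Un_disjoint finite_ram_part Int_Un_distrib2)
  moreover have st: "stab 0 = generate G {face_gen}" "stab (bdry 0) = generate G {b}"
    "stab (bdry 1) = generate G {w}"
    using bdry_1_neq_1 by (simp_all add: stab_def)
  note parts = card_ram_part[of 0, unfolded special_power Q.card_stab st, OF Q.special_canonical(1)]
    card_ram_part[of "bdry 0", unfolded special_power Q.card_stab st, OF Q.special_canonical(2)]
    card_ram_part[of "bdry 1", unfolded special_power Q.card_stab st, OF Q.special_canonical(3)]
  ultimately show ?thesis
    unfolding ramification_points_proj
    by (simp only: of_nat_add parts distrib_left add_ac)
qed

text \<open>No fibre has more than \<open>card N\<close> elements, so every exceptional point is a
  ramification point, and those are finite in number.\<close>

lemma sheeted_covering_proj: "sheeted_covering (card N) (surface G b w) quotient_surface proj"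
  unfolding sheeted_covering_def
proof
  show "continuous_map (surface G b w) quotient_surface proj" by (rule continuous_map_proj)
  have "{y \<in> topspace quotient_surface. \<not> (finite (fibre (surface G b w) proj y) \<and>
           card (fibre (surface G b w) proj y) = card N)}
      \<subseteq> ramification_points (card N) (surface G b w) quotient_surface proj"
  proof
    fix y assume "y \<in> {y \<in> topspace quotient_surface. \<not> (finite (fibre (surface G b w) proj y) \<and>
           card (fibre (surface G b w) proj y) = card N)}"
    then have y: "y \<in> topspace quotient_surface" "\<not> (finite (fibre (surface G b w) proj y) \<and>
           card (fibre (surface G b w) proj y) = card N)" by auto
    obtain g u where gu: "g \<in> carrier G" "u \<in> canonical" "y = Q.cls (N #> g) (u ^ face_ram)"
      using y(1) by (rule quotient_surface_cases)
    show "y \<in> ramification_points (card N) (surface G b w) quotient_surface proj"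
      unfolding ramification_points_def
      using y card_fibre_proj(1)[OF gu(1,2)] card_fibre_eq_iff[OF gu(1,2)] gu(3) by simp
  qed
  moreover have "finite (ramification_points (card N) (surface G b w) quotient_surface proj)"
    unfolding ramification_points_proj by (simp add: finite_ram_part)
  ultimately show "finite {y \<in> topspace quotient_surface. \<not> (finite (fibre (surface G b w) proj y) \<and>
           card (fibre (surface G b w) proj y) = card N)}"
    by (rule finite_subset)
qed

section \<open>Semiregularity, smoothness and Euler characteristics\<close>

lemma semiregular_on_rcosets_iff:
  assumes S: "subgroup S G"
  shows "(\<forall>C\<in>rcosets S. {n \<in> N. C #> n = C} = {\<one>}) \<longleftrightarrow> S \<inter> N = {\<one>}"
proof
  interpret S: subgroup S G by fact
  assume free: "\<forall>C\<in>rcosets S. {n \<in> N. C #> n = C} = {\<one>}"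
  have "S \<in> rcosets S" by (rule S.subgroup_in_rcosets[OF is_group])
  then have "{n \<in> N. S #> n = S} = {\<one>}" using free by blast
  moreover have "S #> n = S" if "n \<in> S" for n using that by (rule S.rcos_const[OF is_group])
  ultimately have "S \<inter> N \<subseteq> {\<one>}" by blast
  then show "S \<inter> N = {\<one>}" using S.one_closed N.one_closed by blast
next
  interpret S: subgroup S G by fact
  assume triv: "S \<inter> N = {\<one>}"
  show "\<forall>C\<in>rcosets S. {n \<in> N. C #> n = C} = {\<one>}"
  proof
    fix C assume "C \<in> rcosets S"
    then obtain g where g: "g \<in> carrier G" "C = S #> g" unfolding RCOSETS_def by blast
    have "n = \<one>" if n: "n \<in> N" "C #> n = C" for n
    proof -
      \<comment> \<open>If \<open>n\<close> fixes \<open>S #> g\<close>, then its conjugate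
        \<open>g \<otimes> n \<otimes> inv g\<close> lies in \<open>S\<close>; normality keeps this
        conjugate in \<open>N\<close>.\<close>
      have "S #> (g \<otimes> n) = S #> g" using n g coset_mult_assoc[OF S.subset g(1), of n] by simp
      then have "g \<otimes> n \<in> S #> g" using rcos_self[of "g \<otimes> n" S] S g n by auto
      then have "g \<otimes> n \<otimes> inv g \<in> S" using S.rcos_module[OF is_group g(1), of "g \<otimes> n"] g n by simp
      moreover have "g \<otimes> n \<otimes> inv g \<in> N" using N.inv_op_closed2[OF g(1) n(1)] .
      ultimately have "g \<otimes> n \<otimes> inv g = \<one>" using triv by blast
      then have "g \<otimes> n = g" using inv_solve_right'[of \<one> "g \<otimes> n" g] g n by simp
      then show ?thesis using g n by simp
    qed
    moreover have "C #> \<one> = C" using g coset_mult_assoc[OF S.subset g(1) one_closed] by simp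
    ultimately show "{n \<in> N. C #> n = C} = {\<one>}" using N.one_closed by blast
  qed
qed

lemma acts_semiregularly_iff:
  "acts_semiregularly G N (cell_act G) (vertices G b w \<union> faces G b w) \<longleftrightarrow>
     generate G {b} \<inter> N = {\<one>} \<and> generate G {w} \<inter> N = {\<one>} \<and> generate G {face_gen} \<inter> N = {\<one>}"
proof -
  have "acts_semiregularly G N (cell_act G) (vertices G b w \<union> faces G b w) \<longleftrightarrow>
    (\<forall>C\<in>rcosets (generate G {b}). {n \<in> N. C #> n = C} = {\<one>}) \<and>
    (\<forall>C\<in>rcosets (generate G {w}). {n \<in> N. C #> n = C} = {\<one>}) \<and>
    (\<forall>C\<in>rcosets (generate G {face_gen}). {n \<in> N. C #> n = C} = {\<one>})"
    unfolding acts_semiregularly_def vertices_def faces_def ball_Un ball_simps cell_act.simps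
      cell.inject by (rule conj_assoc)
  then show ?thesis by (simp only: semiregular_on_rcosets_iff generate_is_subgroup
      empty_subsetI insert_subset b_closed w_closed m_closed simp_thms)
qed

lemma ord_eq_iff:
  assumes "c \<in> carrier G"
  shows "ord c = Q.ord (N #> c) \<longleftrightarrow> generate G {c} \<inter> N = {\<one>}"
proof -
  have "ord c = card (generate G {c} \<inter> N) * Q.ord (N #> c)"
    by (rule ord_eq_card_Int_mult_ord_FactGroup[OF finite_carrier normal_N assms])
  moreover have "Q.ord (N #> c) > 0" using Q.ord_ge_1[OF Q.finite_carrier coset_closed[OF assms]] by simp
  ultimately have "ord c = Q.ord (N #> c) \<longleftrightarrow> card (generate G {c} \<inter> N) = 1" by auto
  also have "\<dots> \<longleftrightarrow> generate G {c} \<inter> N = {\<one>}"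
    using assms by (intro card_Int_N_eq_1_iff generate_is_subgroup) simp
  finally show ?thesis .
qed

lemma smooth_covering_iff:
  "smooth_covering G b w (G Mod N) (N #> b) (N #> w) \<longleftrightarrow>
     generate G {b} \<inter> N = {\<one>} \<and> generate G {w} \<inter> N = {\<one>} \<and> generate G {face_gen} \<inter> N = {\<one>}"
  unfolding smooth_covering_def quotient_face_gen prod.inject
  by (simp only: ord_eq_iff b_closed w_closed m_closed)

text \<open>Lagrange's theorem in both groups, with \<open>ord c = ?r * ?o\<close>, gives
  \<open>k * ?r = card N * k'\<close>. Both claims follow, as \<open>?r\<close> is positive and
  equals 1 only for a trivial intersection.\<close>

lemma card_rcosets_le:
  assumes c: "c \<in> carrier G"
  defines "k \<equiv> card (rcosets (generate G {c}))"
    and "k' \<equiv> card (rcosets\<^bsub>G Mod N\<^esub> (generate (G Mod N) {N #> c}))"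
  shows "k \<le> card N * k'" and "k = card N * k' \<longleftrightarrow> generate G {c} \<inter> N = {\<one>}"
proof -
  let ?r = "card (generate G {c} \<inter> N)" and ?o = "Q.ord (N #> c)"
  have o: "ord c = ?r * ?o"
    by (rule ord_eq_card_Int_mult_ord_FactGroup[OF finite_carrier normal_N c])
  have G: "k * ord c = card (carrier G)"
    unfolding k_def by (rule card_rcosets_generate[OF c])
  have H: "k' * ?o = card (carrier (G Mod N))"
    unfolding k'_def using c by (intro Q.card_rcosets_generate) simp
  have "card (carrier G) = card N * card (carrier (G Mod N))"
    using lagrange[OF N.is_subgroup] by (simp add: Coset.order_def FactGroup_def mult.commute)
  then have "k * ?r * ?o = card N * k' * ?o" using G H o by (simp add: mult_ac)
  moreover have "?o > 0" using Q.ord_ge_1[OF Q.finite_carrier coset_closed[OF c]] by simp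
  ultimately have eq: "k * ?r = card N * k'" by simp
  have "k \<noteq> 0" "?r \<noteq> 0"
    using G o ord_ge_1[OF finite_carrier c] finite_carrier one_closed
    by (metis card_eq_0_iff empty_iff mult_is_0, metis mult_is_0 not_one_le_zero)
  then show "k \<le> card N * k'" unfolding eq[symmetric] by simp
  have "k = card N * k' \<longleftrightarrow> ?r = 1" unfolding eq[symmetric] using \<open>k \<noteq> 0\<close> by auto
  also have "\<dots> \<longleftrightarrow> generate G {c} \<inter> N = {\<one>}"
    using c by (intro card_Int_N_eq_1_iff generate_is_subgroup) simp
  finally show "k = card N * k' \<longleftrightarrow> generate G {c} \<inter> N = {\<one>}" .
qed

text \<open>The edge terms agree, so the difference is a sum of three nonnegative terms, from black
  vertices, white vertices and faces; it vanishes only if each of them does.\<close>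

lemma euler_char_quotient:
  "euler_char G b w \<le> int (card N) * euler_char (G Mod N) (N #> b) (N #> w)"
  "euler_char G b w = int (card N) * euler_char (G Mod N) (N #> b) (N #> w) \<longleftrightarrow>
     generate G {b} \<inter> N = {\<one>} \<and> generate G {w} \<inter> N = {\<one>} \<and> generate G {face_gen} \<inter> N = {\<one>}"
proof -
  define k where "k = (\<lambda>c. card (rcosets (generate G {c})))"
  define k' where "k' = (\<lambda>c. card (rcosets\<^bsub>G Mod N\<^esub> (generate (G Mod N) {N #> c})))"
  have f: "face_gen \<in> carrier G" by simp
  have le: "int (k c) \<le> int (card N) * int (k' c)"
    and eq: "int (k c) = int (card N) * int (k' c) \<longleftrightarrow> generate G {c} \<inter> N = {\<one>}"
    if "c \<in> carrier G" for c
    using card_rcosets_le[OF that] unfolding k_def k'_def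
    by (simp_all only: of_nat_le_iff of_nat_eq_iff flip: of_nat_mult)
  have "card (carrier G) = card N * card (carrier (G Mod N))"
    using lagrange[OF N.is_subgroup] by (simp add: Coset.order_def FactGroup_def mult.commute)
  then have "euler_char G b w = int (k b) + int (k w) - int (card N) * int (card (carrier (G Mod N))) + int (k face_gen)"
    unfolding euler_char_eq k_def by simp
  moreover have "int (card N) * euler_char (G Mod N) (N #> b) (N #> w) =
      int (card N) * int (k' b) + int (card N) * int (k' w)
        - int (card N) * int (card (carrier (G Mod N))) + int (card N) * int (k' face_gen)"
    unfolding Q.euler_char_eq k'_def quotient_face_gen by (simp add: algebra_simps)
  ultimately show "euler_char G b w \<le> int (card N) * euler_char (G Mod N) (N #> b) (N #> w)"
    and "euler_char G b w = int (card N) * euler_char (G Mod N) (N #> b) (N #> w) \<longleftrightarrow>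
     generate G {b} \<inter> N = {\<one>} \<and> generate G {w} \<inter> N = {\<one>} \<and> generate G {face_gen} \<inter> N = {\<one>}"
    using le[OF b_closed] le[OF w_closed] le[OF f]
    unfolding eq[OF b_closed, symmetric] eq[OF w_closed, symmetric] eq[OF f, symmetric]
    by linarith+
qed

end

theorem mainTheorem6:
  fixes G :: "('a, 'c) monoid_scheme" and b w :: 'a and N :: "'a set"
  assumes "group G" and "finite (carrier G)"
    and "b \<in> carrier G" and "w \<in> carrier G" and "generate G {b, w} = carrier G"
    and "N \<lhd> G"
  defines "Gbar \<equiv> G Mod N" and "bbar \<equiv> N #>\<^bsub>G\<^esub> b" and "wbar \<equiv> N #>\<^bsub>G\<^esub> w"
  shows "sheeted_covering (card N) (surface G b w) (surface Gbar bbar wbar)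
           (natural_projection G b w N)
    \<and> (\<exists>i j k :: nat. i \<in> {0, 1} \<and> j \<in> {0, 1} \<and> k \<in> {0, 1}
         \<and> (i = 0 \<longleftrightarrow> generate G {b} \<inter> N = {\<one>\<^bsub>G\<^esub>})
         \<and> (j = 0 \<longleftrightarrow> generate G {w} \<inter> N = {\<one>\<^bsub>G\<^esub>})
         \<and> (k = 0 \<longleftrightarrow> generate G {b \<otimes>\<^bsub>G\<^esub> w} \<inter> N = {\<one>\<^bsub>G\<^esub>})
         \<and> finite (ramification_points (card N) (surface G b w) (surface Gbar bbar wbar)
             (natural_projection G b w N))
         \<and> real (card (ramification_points (card N) (surface G b w) (surface Gbar bbar wbar)
             (natural_projection G b w N)))
           = real (card (carrier Gbar)) * (real i / real (group.ord Gbar bbar)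
               + real j / real (group.ord Gbar wbar)
               + real k / real (group.ord Gbar (bbar \<otimes>\<^bsub>Gbar\<^esub> wbar))))
    \<and> euler_char G b w \<le> int (card N) * euler_char Gbar bbar wbar
    \<and> (euler_char G b w = int (card N) * euler_char Gbar bbar wbar
         \<longleftrightarrow> smooth_covering G b w Gbar bbar wbar)
    \<and> (smooth_covering G b w Gbar bbar wbar
         \<longleftrightarrow> acts_semiregularly G N (cell_act G) (vertices G b w \<union> faces G b w))"
proof -
  interpret dessin_quotient G b w N
    using assms(1-4,6)
    by (simp add: dessin_quotient_def dessin_def dessin_axioms_def dessin_quotient_axioms_def)
  have "finite (ramification_points (card N) (surface G b w) quotient_surface proj)"
    unfolding ramification_points_proj by (simp add: finite_ram_part)
  then have "\<exists>i j k :: nat. i \<in> {0, 1} \<and> j \<in> {0, 1} \<and> k \<in> {0, 1}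
         \<and> (i = 0 \<longleftrightarrow> generate G {b} \<inter> N = {\<one>\<^bsub>G\<^esub>})
         \<and> (j = 0 \<longleftrightarrow> generate G {w} \<inter> N = {\<one>\<^bsub>G\<^esub>})
         \<and> (k = 0 \<longleftrightarrow> generate G {b \<otimes>\<^bsub>G\<^esub> w} \<inter> N = {\<one>\<^bsub>G\<^esub>})
         \<and> finite (ramification_points (card N) (surface G b w) quotient_surface proj)
         \<and> real (card (ramification_points (card N) (surface G b w) quotient_surface proj))
           = real (card (carrier (G Mod N))) * (real i / real (Q.ord (N #>\<^bsub>G\<^esub> b))
               + real j / real (Q.ord (N #>\<^bsub>G\<^esub> w)) + real k / real Q.face_deg)"
    \<comment> \<open>The witnesses are the indicators of nontrivial intersection from
      \<open>card_ramification_points\<close>.\<close>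
    by (intro exI[of _ "if generate G {b} \<inter> N = {\<one>\<^bsub>G\<^esub>} then 0 else 1"]
        exI[of _ "if generate G {w} \<inter> N = {\<one>\<^bsub>G\<^esub>} then 0 else 1"]
        exI[of _ "if generate G {b \<otimes>\<^bsub>G\<^esub> w} \<inter> N = {\<one>\<^bsub>G\<^esub>} then 0 else 1"]
        conjI card_ramification_points) simp_all
  \<comment> \<open>Equality of Euler characteristics, smoothness and semiregularity all amount to
    the triviality of the same three intersections with \<open>N\<close>.\<close>
  then show ?thesis
    unfolding Gbar_def bbar_def wbar_def
    using sheeted_covering_proj euler_char_quotient smooth_covering_iff acts_semiregularly_iff
    by simp
qed

end
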